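(* Let $X$ and $Y$ be two real Banach spaces and let $\Omega:X\times Y\to\mathbb R$ be a bounded non-degenerate bilinear form. Let $\mathcal{FR}_0^{-1,sa}(\Omega)$ be the set of linear Fredholm relations $X\leadsto Y$ with index $0$ that are skew-adjoint with respect to $\Omega$, with the gap topology. For $a\in\{0,1\}$ define $$\mathcal{FR}_{a;0}^{-1,sa}(\Omega):=\{T\in\mathcal{FR}_0^{-1,sa}(\Omega):\ \dim\ker T\equiv a\pmod 2\}.$$ Then the space $\mathcal{FR}_0^{-1,sa}(\Omega)$ has exactly two path components, namely $\mathcal{FR}_{0;0}^{-1,sa}(\Omega)$ and $\mathcal{FR}_{1;0}^{-1,sa}(\Omega)$.
   Context: A bilinear form $\Omega:X\times Y\to\mathbb R$ is non-degenerate if $\Omega(x,\cdot)=0$ implies $x=0$ and $\Omega(\cdot,y)=0$ implies $y=0$. A linear relation $A:X\leadsto Y$ is a linear subspace $A\subset X\times Y$; $\ker A=\{x:(x,0)\in A\}$, $\operatorname{im}A=\{y:\exists x,\ (x,y)\in A\}$. A closed linear relation $A$ (closed in $X\times Y$) is Fredholm if $\dim\ker A<\infty$, $\operatorname{im}A$ is closed and $\dim Y/\operatorname{im}A<\infty$; then its index is $\dim\ker A-\dim Y/\operatorname{im}A$. The $\Omega$-adjoint of $A$ is $A^\Omega:=\{(x',y')\in X\times Y:\ \Omega(x,y')=\Omega(x',y)\ \forall (x,y)\in A\}$. $A$ is skew-adjoint with respect to $\Omega$ if $\{(x,-y):(x,y)\in A\}=A^\Omega$. The gap topology on closed subspaces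 of $X\times Y$ is the topology defined by $\hat\delta(M,N)=\max\{\delta(M,N),\delta(N,M)\}$, $\delta(M,N)=\sup_{u\in M,\|u\|=1}\operatorname{dist}(u,N)$ ($=0$ if $M=\{0\}$).
   Formalization: The space X is assumed to be nonzero: for X = Y = {0} the only relation is {0}, so there is a single path component, the odd-kernel part is empty, and the claim of exactly two path components fails. *)

theory Defs
  imports "HOL-Analysis.Analysis"
begin

definition nondegenerate :: "('x::zero \<Rightarrow> 'y::zero \<Rightarrow> real) \<Rightarrow> bool" where
  "nondegenerate \<Omega> \<longleftrightarrow>
     (\<forall>x. (\<forall>y. \<Omega> x y = 0) \<longrightarrow> x = 0) \<and> (\<forall>y. (\<forall>x. \<Omega> x y = 0) \<longrightarrow> y = 0)"


section \<open>Finite-dimensional subspaces and quotients\<close>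

definition finite_dimensional :: "'a::real_vector set \<Rightarrow> bool" where
  "finite_dimensional S \<longleftrightarrow> (\<exists>B. finite B \<and> span B = S)"

text \<open>
  The quotient of a type by a varying subspace \<open>V\<close> is not available as a type.  The following
  says that the classes of the elements of the finite set \<open>B\<close> are pairwise distinct and form a basis
  of the quotient of the whole space by \<open>V\<close>: a linear combination of classes vanishes iff the
  combination of representatives lies in \<open>V\<close>, and two classes agree iff the difference of the
  representatives lies in \<open>V\<close>.
\<close>

definition quotient_basis :: "'a::real_vector set \<Rightarrow> 'a set \<Rightarrow> bool" where
  "quotient_basis V B \<longleftrightarrow> finite B \<and>
     (\<forall>c. (\<Sum>b\<in>B. c b *\<^sub>R b) \<in> V \<longrightarrow> (\<forall>b\<in>B. c b = 0)) \<and>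
     (\<forall>y. \<exists>c. y - (\<Sum>b\<in>B. c b *\<^sub>R b) \<in> V)"

definition finite_codimensional :: "'a::real_vector set \<Rightarrow> bool" where
  "finite_codimensional V \<longleftrightarrow> (\<exists>B. quotient_basis V B)"

text \<open>As for the library's \<open>dim\<close>, the value is meaningful only in the finite-dimensional case.\<close>

definition codim :: "'a::real_vector set \<Rightarrow> nat" where
  "codim V = (if finite_codimensional V then card (SOME B. quotient_basis V B) else 0)"


section \<open>Linear relations\<close>

text \<open>
  A linear relation is a subspace \<open>A\<close> of the product space; its image is \<open>Range A\<close>.
\<close>

definition rel_ker :: "('x \<times> 'y::zero) set \<Rightarrow> 'x set" where
  "rel_ker A = {x. (x, 0) \<in> A}"

definition fredholm_relation :: "('x::real_normed_vector \<times> 'y::real_normed_vector) set \<Rightarrow> bool" where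
  "fredholm_relation A \<longleftrightarrow> subspace A \<and> closed A \<and>
     finite_dimensional (rel_ker A) \<and> closed (Range A) \<and> finite_codimensional (Range A)"

definition fredholm_index :: "('x::real_normed_vector \<times> 'y::real_normed_vector) set \<Rightarrow> int" where
  "fredholm_index A = int (dim (rel_ker A)) - int (codim (Range A))"

definition rel_adjoint :: "('x \<Rightarrow> 'y \<Rightarrow> real) \<Rightarrow> ('x \<times> 'y) set \<Rightarrow> ('x \<times> 'y) set" where
  "rel_adjoint \<Omega> A = {(x', y'). \<forall>(x, y)\<in>A. \<Omega> x y' = \<Omega> x' y}"

definition skew_adjoint :: "('x \<Rightarrow> 'y::uminus \<Rightarrow> real) \<Rightarrow> ('x \<times> 'y) set \<Rightarrow> bool" where
  "skew_adjoint \<Omega> A \<longleftrightarrow> {(x, - y) |x y. (x, y) \<in> A} = rel_adjoint \<Omega> A"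


section \<open>The gap topology\<close>

text \<open>
  On a product space the library norm is the Euclidean combination of the two norms; replacing a
  norm by an equivalent one does not change the gap topology.
\<close>

definition gap_delta :: "'a::real_normed_vector set \<Rightarrow> 'a set \<Rightarrow> real" where
  "gap_delta M N = (if M = {0} then 0 else (SUP u\<in>{u \<in> M. norm u = 1}. infdist u N))"

definition gap :: "'a::real_normed_vector set \<Rightarrow> 'a set \<Rightarrow> real" where
  "gap M N = max (gap_delta M N) (gap_delta N M)"

definition closed_subspaces :: "'a::real_normed_vector set set" where
  "closed_subspaces = {M. subspace M \<and> closed M}"

text \<open>
  The gap need not satisfy the triangle inequality, so the topology is given directly by its open
  sets: \<open>U\<close> is open iff it contains a gap ball about each of its points.
\<close>

definition gap_topology :: "'a::real_normed_vector set topology" where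
  "gap_topology = topology (\<lambda>U. U \<subseteq> closed_subspaces \<and>
     (\<forall>M\<in>U. \<exists>e>0. \<forall>N\<in>closed_subspaces. gap M N < e \<longrightarrow> N \<in> U))"

lemma openin_gap_topology:
  "openin gap_topology U \<longleftrightarrow> U \<subseteq> closed_subspaces \<and>
     (\<forall>M\<in>U. \<exists>e>0. \<forall>N\<in>closed_subspaces. gap M N < e \<longrightarrow> N \<in> U)"
proof -
  have "istopology (\<lambda>U::'a set set. U \<subseteq> closed_subspaces \<and>
     (\<forall>M\<in>U. \<exists>e>0. \<forall>N\<in>closed_subspaces. gap M N < e \<longrightarrow> N \<in> U))"
    (is "istopology ?P")
    unfolding istopology_def
  proof (intro conjI allI impI)
    fix S T :: "'a set set" assume S: "?P S" and T: "?P T"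
    show "S \<inter> T \<subseteq> closed_subspaces" using S by blast
    show "\<forall>M\<in>S \<inter> T. \<exists>e>0. \<forall>N\<in>closed_subspaces. gap M N < e \<longrightarrow> N \<in> S \<inter> T"
    proof
      fix M assume M: "M \<in> S \<inter> T"
      obtain d where d: "d > 0" "\<forall>N\<in>closed_subspaces. gap M N < d \<longrightarrow> N \<in> S"
        using S M by blast
      obtain e where e: "e > 0" "\<forall>N\<in>closed_subspaces. gap M N < e \<longrightarrow> N \<in> T"
        using T M by blast
      show "\<exists>e>0. \<forall>N\<in>closed_subspaces. gap M N < e \<longrightarrow> N \<in> S \<inter> T"
        using d e by (intro exI[of _ "min d e"]) auto
    qed
  next
    fix \<K> :: "'a set set set" assume K: "\<forall>K\<in>\<K>. ?P K"
    show "\<Union>\<K> \<subseteq> closed_subspaces" using K by blast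
    show "\<forall>M\<in>\<Union>\<K>. \<exists>e>0. \<forall>N\<in>closed_subspaces. gap M N < e \<longrightarrow> N \<in> \<Union>\<K>"
      using K by (meson UnionE UnionI)
  qed
  then show ?thesis
    by (simp add: gap_topology_def topology_inverse')
qed

lemma topspace_gap_topology: "topspace gap_topology = closed_subspaces"
proof
  show "topspace gap_topology \<subseteq> closed_subspaces"
    using openin_topspace[of gap_topology] openin_gap_topology by blast
  have "openin gap_topology closed_subspaces"
    by (auto simp: openin_gap_topology intro: exI[of _ 1])
  then show "closed_subspaces \<subseteq> topspace gap_topology"
    by (rule openin_subset)
qed


section \<open>Skew-adjoint Fredholm relations of index zero\<close>

definition FR0_sa ::
    "('x::real_normed_vector \<Rightarrow> 'y::real_normed_vector \<Rightarrow> real) \<Rightarrow> ('x \<times> 'y) set set" where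
  "FR0_sa \<Omega> = {T. fredholm_relation T \<and> fredholm_index T = 0 \<and> skew_adjoint \<Omega> T}"

definition FR0_sa_parity ::
    "nat \<Rightarrow> ('x::real_normed_vector \<Rightarrow> 'y::real_normed_vector \<Rightarrow> real) \<Rightarrow> ('x \<times> 'y) set set" where
  "FR0_sa_parity a \<Omega> = {T \<in> FR0_sa \<Omega>. dim (rel_ker T) mod 2 = a mod 2}"

definition FR0_sa_space ::
    "('x::real_normed_vector \<Rightarrow> 'y::real_normed_vector \<Rightarrow> real) \<Rightarrow> ('x \<times> 'y) set topology" where
  "FR0_sa_space \<Omega> = subtopology gap_topology (FR0_sa \<Omega>)"

lemma topspace_FR0_sa_space: "topspace (FR0_sa_space \<Omega>) = FR0_sa \<Omega>"
  by (auto simp: FR0_sa_space_def topspace_gap_topology closed_subspaces_def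
      FR0_sa_def fredholm_relation_def)

end

theory Submission
  imports Defs
begin

text \<open>
  A relation is skew-adjoint iff it is its own orthogonal complement for the symmetric form
  \<open>((x, y), (x', y')) \<mapsto> \<Omega> x y' + \<Omega> x' y\<close>. Every path needed is
  \<open>t \<mapsto> (1 + t N) T\<close> with a bounded infinitesimal isometry \<open>N\<close> of square zero. Three kinds of
  \<open>N\<close> occur. One flattens \<open>T\<close> to \<open>ker T \<times> (ker T)\<^sup>\<bottom>\<close>, where \<open>N\<close> is bounded by the closed graph
  theorem; one has rank two and removes two dimensions of the kernel; one moves a kernel line to
  any other. So only \<open>dim ker T\<close> modulo 2 can obstruct a path.

  Conversely, fix a finite-codimensional complement of \<open>ker T0\<close> in \<open>X\<close> and a complement of the image
  in \<open>Y\<close>; their product \<open>L\<close> is transversal to \<open>T0\<close>, hence to every \<open>T\<close> near \<open>T0\<close>. The decomposition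
  \<open>T + L\<close> yields an alternating form on \<open>ker T0\<close> with radical isomorphic to \<open>ker T\<close>, and an
  alternating form has even rank.
\<close>

subsection \<open>The gap\<close>

text \<open>The form \<Omega> is merely non-degenerate: neither space need represent the dual of the
  other, so no duality is available for arbitrary closed subspaces. What survives is duality for
  finite sets, since independent vectors of \<open>X\<close> have biorthogonal vectors in
  \<open>Y\<close>. Isotropy alone only puts the range of \<open>T\<close> inside the annihilator of
  its kernel. Index 0 turns this into an equality by counting codimensions, and all constructions
  rest on that equality. The invariant is the one that splits the Lagrangians of a
  finite-dimensional split quadratic form into two families: the parity of the dimension of the
  intersection with a fixed Lagrangian, here \<open>X \<times> {0}\<close>. Kernel dimensions
  disappear in pairs because the perturbation comes from a skew map, whose rank is even.\<close>

text \<open>Together with \<open>gap_delta_less\<close> this trades the supremum over unit vectors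
  for a homogeneous approximation property, the only form in which the gap is used later.\<close>

lemma gap_delta_le:
  assumes "subspace M" "c \<ge> 0" "\<And>u. u \<in> M \<Longrightarrow> \<exists>v\<in>N. norm (u - v) \<le> c * norm u"
  shows "gap_delta M N \<le> c"
proof (cases "M = {0}")
  case True
  then show ?thesis using assms by (simp add: gap_delta_def)
next
  case False
  then obtain m where m: "m \<in> M" "m \<noteq> 0"
    using subspace_0[OF assms(1)] by blast
  then have "sgn m \<in> {u \<in> M. norm u = 1}"
    using assms(1) by (simp add: sgn_div_norm subspace_scale)
  then have ne: "{u \<in> M. norm u = 1} \<noteq> {}" by blast
  have "infdist u N \<le> c" if u: "u \<in> {u \<in> M. norm u = 1}" for u
  proof -
    obtain v where "v \<in> N" "norm (u - v) \<le> c * norm u"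
      using assms(3) u by blast
    then show ?thesis using infdist_le2[of v N u c] u by (simp add: dist_norm)
  qed
  then show ?thesis
    unfolding gap_delta_def using False by (simp add: cSUP_least[OF ne, simplified])
qed

text \<open>The distance to \<open>N\<close> need not be attained; the strict bound is what provides
  an actual \<open>v\<close>.\<close>

lemma gap_delta_less:
  assumes "subspace M" "subspace N" "gap_delta M N < c" "u \<in> M"
  shows "\<exists>v\<in>N. norm (u - v) \<le> c * norm u"
proof (cases "u = 0")
  case True
  then show ?thesis using subspace_0[OF assms(2)] by force
next
  case False
  then have M: "M \<noteq> {0}" using assms by blast
  have N0: "0 \<in> N" using assms(2) by (rule subspace_0)
  define w where "w = u /\<^sub>R norm u"
  have w: "w \<in> {u \<in> M. norm u = 1}"
    using False assms by (simp add: w_def subspace_scale)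
  have "infdist w N \<le> (SUP u\<in>{u \<in> M. norm u = 1}. infdist u N)"
  \<comment> \<open>A real supremum says nothing about unbounded sets; since
    \<open>0 \<in> N\<close>, distances of unit vectors are at most 1.\<close>
  proof (rule cSUP_upper[OF w])
    show "bdd_above ((\<lambda>u. infdist u N) ` {u \<in> M. norm u = 1})"
    proof (rule bdd_aboveI2)
      show "infdist u N \<le> 1" if "u \<in> {u \<in> M. norm u = 1}" for u
        using infdist_le[OF N0, of u] that by simp
    qed
  qed
  then have "infdist w N < c"
    using M assms(3) by (simp add: gap_delta_def)
  then obtain v where v: "v \<in> N" "dist w v < c"
    using N0 cInf_lessD[of "dist w ` N" c] by (auto simp: infdist_def split: if_splits)
  have "u - norm u *\<^sub>R v = norm u *\<^sub>R (w - v)"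
    using False by (simp add: w_def scaleR_right_diff_distrib)
  then have "norm (u - norm u *\<^sub>R v) = norm u * dist w v"
    by (simp add: dist_norm)
  also have "\<dots> \<le> c * norm u" using v by (subst mult.commute) (simp add: mult_right_mono)
  finally show ?thesis
    using v assms(2) subspace_scale by blast
qed

lemma gap_self: "subspace M \<Longrightarrow> gap M M \<le> 0"
  unfolding gap_def by (auto intro!: gap_delta_le)

text \<open>Approximate \<open>u\<close> by \<open>v\<close> and \<open>v\<close> by
  \<open>w\<close>. As \<open>c \<le> 1\<close>, \<open>norm v\<close> is at most
  \<open>2 * norm u\<close>, so the errors add up to \<open>c + 2 * c\<close>. This replaces the
  triangle inequality.\<close>

lemma gap_delta_weak_triangle:
  assumes "subspace L" "subspace M" "subspace N"
    and "gap_delta L M < c" "gap_delta M N < c" "c \<le> 1"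
  shows "gap_delta L N \<le> 3 * c"
proof -
  have "0 \<in> L" using assms subspace_0 by blast
  have *: "norm (u - w) \<le> 3 * c * norm u" if uv: "norm (u - v) \<le> c * norm u" and vw: "norm (v - w) \<le> c * norm v"
    and c: "0 \<le> c" for u v w :: 'a
  proof -
    have "norm (u - v) \<le> 1 * norm u"
      using uv assms(6) mult_right_mono[of c 1 "norm u"] by simp
    then have "norm v \<le> 2 * norm u"
      using norm_triangle_ineq3[of u v] by (smt (verit) norm_minus_commute norm_triangle_sub)
    then have "c * norm v \<le> c * (2 * norm u)" using c by (rule mult_left_mono)
    moreover have "norm (u - w) \<le> norm (u - v) + norm (v - w)"
      using norm_triangle_ineq[of "u - v" "v - w"] by simp
    ultimately show ?thesis using uv vw by simp
  qed
  show ?thesis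
  proof (cases "c \<ge> 0")
    case True
    show ?thesis
    proof (rule gap_delta_le[OF assms(1)])
      fix u assume "u \<in> L"
      then obtain v where v: "v \<in> M" "norm (u - v) \<le> c * norm u"
        using gap_delta_less[OF assms(1,2,4)] by blast
      then obtain w where "w \<in> N" "norm (v - w) \<le> c * norm v"
        using gap_delta_less[OF assms(2,3,5)] by blast
      then show "\<exists>w\<in>N. norm (u - w) \<le> 3 * c * norm u"
        using *[OF v(2) _ True] by blast
    qed (use True in simp)
  next
    \<comment> \<open>A negative \<open>c\<close> forces \<open>L = {0}\<close>, whose
      \<open>gap_delta\<close> is 0 by convention and not below \<open>c\<close>, so this case is
      void.\<close>
    case False
    have "x = 0" if "x \<in> L" for x
    proof -
      obtain v where "norm (x - v) \<le> c * norm x"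
        using gap_delta_less[OF assms(1,2,4) \<open>x \<in> L\<close>] by blast
      then show ?thesis using False by (smt (verit) mult_neg_pos norm_ge_zero zero_less_norm_iff)
    qed
    then have "L = {0}" using \<open>0 \<in> L\<close> by blast
    then have "gap_delta L M = 0" by (simp add: gap_delta_def)
    then show ?thesis using False assms(4) by simp
  qed
qed

lemma gap_weak_triangle:
  assumes "subspace L" "subspace M" "subspace N" "gap L M < c" "gap M N < c" "c \<le> 1"
  shows "gap L N \<le> 3 * c"
  using assms gap_delta_weak_triangle[of L M N c] gap_delta_weak_triangle[of N M L c]
  by (simp add: gap_def)

subsection \<open>The closed graph theorem\<close>

text \<open>Successive approximation: correcting the residual gains a factor \<open>1/2\<close> each time.\<close>

lemma surjective_by_approximation:
  fixes A :: "('u::banach \<times> 'z::real_normed_vector) set"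
  assumes sub: "subspace A" and cl: "closed A" and c: "c \<ge> 0"
    and appr: "\<And>z. \<exists>u z'. (u, z') \<in> A \<and> norm u \<le> c * norm z \<and> norm (z - z') \<le> norm z / 2"
  shows "\<exists>u. (u, z) \<in> A \<and> norm u \<le> 2 * c * norm z"
proof -
  obtain f g where fg: "\<And>z. (f z, g z) \<in> A" "\<And>z. norm (f z) \<le> c * norm z"
      "\<And>z. norm (z - g z) \<le> norm z / 2"
    using appr by metis
  define r where "r n = ((\<lambda>z. z - g z) ^^ n) z" for n
  have r0: "r 0 = z" and rS: "r (Suc n) = r n - g (r n)" for n
    by (auto simp: r_def)
  have rn: "norm (r n) \<le> norm z * (1/2) ^ n" for n
  proof (induction n)
    case (Suc n)
    then show ?case using fg(3)[of "r n"] by (simp add: rS)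
  qed (simp add: r0)
  have fn: "norm (f (r n)) \<le> c * norm z * (1/2) ^ n" for n
    using fg(2)[of "r n"] mult_left_mono[OF rn[of n] c] by (simp add: mult.assoc)
  have sm: "summable (\<lambda>n. c * norm z * (1/2::real) ^ n)"
    by (intro summable_mult summable_geometric) auto
  have smf: "summable (\<lambda>n. norm (f (r n)))"
    by (rule summable_comparison_test'[OF sm, of 0]) (use fn in auto)
  \<comment> \<open>After \<open>n\<close> corrections the sum of the \<open>f (r i)\<close> solves
    the problem up to the residual \<open>r n\<close>; closedness of \<open>A\<close> is applied to
    these points.\<close>
  have part: "(\<Sum>i<n. f (r i), z - r n) \<in> A" for n
  proof (induction n)
    case 0
    show ?case using subspace_0[OF sub] by (simp add: r0 zero_prod_def)
  next
    case (Suc n)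
    show ?case using subspace_add[OF sub Suc fg(1)[of "r n"]] by (simp add: rS algebra_simps)
  qed
  have "r \<longlonglongrightarrow> 0"
  proof (rule Lim_null_comparison)
    show "\<forall>\<^sub>F n in sequentially. norm (r n) \<le> norm z * (1/2) ^ n" using rn by simp
    show "(\<lambda>n. norm z * (1/2) ^ n) \<longlonglongrightarrow> 0"
      by (intro tendsto_mult_right_zero LIMSEQ_power_zero) auto
  qed
  then have "(\<lambda>n. z - r n) \<longlonglongrightarrow> z" using tendsto_diff[OF tendsto_const[of z]] by fastforce
  moreover have "(\<lambda>n. \<Sum>i<n. f (r i)) \<longlonglongrightarrow> (\<Sum>i. f (r i))"
    using summable_LIMSEQ[OF summable_norm_cancel[OF smf]] .
  ultimately have "(\<lambda>n. (\<Sum>i<n. f (r i), z - r n)) \<longlonglongrightarrow> (\<Sum>i. f (r i), z)"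
    by (rule tendsto_Pair[rotated])
  then have "(\<Sum>i. f (r i), z) \<in> A"
    using closed_sequentially[OF cl, of "\<lambda>n. (\<Sum>i<n. f (r i), z - r n)"] part by blast
  moreover have "norm (\<Sum>i. f (r i)) \<le> (\<Sum>n. c * norm z * (1/2::real) ^ n)"
    using summable_norm[OF smf] suminf_le[OF fn smf sm] by linarith
  moreover have "(\<Sum>n. c * norm z * (1/2::real) ^ n) = 2 * c * norm z"
    using suminf_mult[of "\<lambda>n. (1/2::real) ^ n" "c * norm z"] suminf_geometric[of "1/2::real"]
    by (simp add: summable_geometric)
  ultimately show ?thesis by fastforce
qed

text \<open>The graph is written with the value first, so that
  \<open>surjective_by_approximation\<close> bounds \<open>f z\<close> by \<open>z\<close>. Baire's
  theorem supplies the approximate solutions that it asks for.\<close>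

lemma closed_graph:
  fixes f :: "'a::banach \<Rightarrow> 'b::banach"
  assumes lin: "linear f" and cl: "closed {(f y, y) |y. True}"
  shows "bounded_linear f"
proof -
  interpret linear f by fact
  define S where "S n = {y. norm (f y) \<le> real n}" for n :: nat
  have "\<exists>n. interior (closure (S n)) \<noteq> {}"
  proof (rule ccontr)
    assume "\<not> ?thesis"
    then have "(euclidean::'a topology) interior_of \<Union>(range (\<lambda>n. closure (S n))) = {}"
      by (intro Baire_category_alt) (auto simp: completely_metrizable_space_euclidean)
    moreover have "\<Union>(range (\<lambda>n. closure (S n))) = UNIV"
    proof -
      have "y \<in> closure (S (nat \<lceil>norm (f y)\<rceil>))" for y
        using closure_subset by (force simp: S_def intro: subsetD[OF closure_subset] of_nat_ceiling)
      then show ?thesis by blast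
    qed
    ultimately show False by simp
  qed
  then obtain n y0 where "y0 \<in> interior (closure (S n))" by blast
  then obtain r where r: "r > 0" "cball y0 r \<subseteq> closure (S n)"
    by (auto simp: mem_interior_cball)
  have sub: "subspace {(f y, y) |y. True}"
    unfolding subspace_def
  proof (intro conjI allI ballI)
    show "0 \<in> {(f y, y) |y. True}" using zero by (force simp: zero_prod_def)
  next
    fix a b assume "a \<in> {(f y, y) |y. True}" "b \<in> {(f y, y) |y. True}"
    then show "a + b \<in> {(f y, y) |y. True}" by (auto simp: add)
  next
    fix c :: real and a assume "a \<in> {(f y, y) |y. True}"
    then show "c *\<^sub>R a \<in> {(f y, y) |y. True}" by (auto simp: scale)
  qed
  \<comment> \<open>Differences of points of \<open>S n\<close> have values of norm at most
    \<open>2 * n\<close>; rescaling by \<open>s = r / norm z\<close> below gives this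
    factor.\<close>
  define c where "c = 2 * real n / r"
  have c0: "c \<ge> 0" using r by (simp add: c_def)
  have "\<exists>u. (u, z) \<in> {(f y, y) |y. True} \<and> norm u \<le> 2 * c * norm z" for z
  proof (rule surjective_by_approximation[OF sub cl c0])
    fix z :: 'a
    show "\<exists>u z'. (u, z') \<in> {(f y, y) |y. True} \<and> norm u \<le> c * norm z \<and> norm (z - z') \<le> norm z / 2"
    proof (cases "z = 0")
      case True
      then show ?thesis using zero by force
    next
      case False
      \<comment> \<open>The scaling moves \<open>y0 + s *\<^sub>R z\<close> to the boundary of the
        ball in \<open>closure (S n)\<close>. Two errors of \<open>r / 4\<close> then make
        \<open>p - q\<close> agree with \<open>s *\<^sub>R z\<close> up to \<open>r / 2\<close>,
        which is half of its norm.\<close>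
      define s where "s = r / norm z"
      have s: "s > 0" using r False by (simp add: s_def)
      have "y0 + s *\<^sub>R z \<in> closure (S n)" "y0 \<in> closure (S n)"
        using r False by (auto simp: s_def dist_norm intro!: subsetD[OF r(2)])
      then obtain p q where pq: "p \<in> S n" "q \<in> S n" "dist p (y0 + s *\<^sub>R z) < r / 4" "dist q y0 < r / 4"
        using r unfolding closure_approachable by (metis zero_less_divide_iff zero_less_numeral)
      define w where "w = (p - q) /\<^sub>R s"
      have "norm (s *\<^sub>R z - (p - q)) \<le> r / 2"
      proof -
        have "s *\<^sub>R z - (p - q) = (q - y0) - (p - (y0 + s *\<^sub>R z))" by (simp add: algebra_simps)
        then have "norm (s *\<^sub>R z - (p - q)) \<le> dist q y0 + dist p (y0 + s *\<^sub>R z)"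
          unfolding dist_norm by (metis norm_triangle_ineq4)
        then show ?thesis using pq by linarith
      qed
      moreover have "s *\<^sub>R z - (p - q) = s *\<^sub>R (z - w)"
        using s by (simp add: w_def scaleR_right_diff_distrib)
      ultimately have "s * norm (z - w) \<le> r / 2" using s by simp
      then have 1: "norm (z - w) \<le> norm z / 2"
        using s r False by (simp add: s_def field_simps)
      have "norm (f (p - q)) \<le> 2 * real n"
        using pq norm_triangle_ineq4[of "f p" "f q"] by (simp add: S_def diff)
      then have "norm (f w) \<le> (2 * real n) / s"
        using s by (simp add: w_def scale divide_simps mult.commute)
      then have "norm (f w) \<le> c * norm z" by (simp add: c_def s_def)
      then show ?thesis using 1 by blast
    qed
  qed
  then have "norm (f z) \<le> norm z * (2 * c)" for z
    by (smt (verit) Pair_inject mem_Collect_eq mult.commute)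
  then show ?thesis
    by (intro bounded_linear_intro[where K="2*c"]) (auto simp: add scale)
qed

subsection \<open>Codimension and alternating forms\<close>

text \<open>Steinitz exchange modulo \<open>V\<close>: replacing each \<open>s\<close> by a
  representative \<open>p s\<close> in \<open>span Q\<close> alters linear combinations only by
  elements of \<open>V\<close>, so the representatives are independent.\<close>

lemma quotient_basis_card_le:
  assumes V: "subspace V" and Q: "quotient_basis V Q"
    and S: "finite S" "\<And>c. (\<Sum>s\<in>S. c s *\<^sub>R s) \<in> V \<Longrightarrow> \<forall>s\<in>S. c s = 0"
  shows "card S \<le> card Q"
proof -
  have Qf: "finite Q" and Qs: "\<And>y. \<exists>c. y - (\<Sum>b\<in>Q. c b *\<^sub>R b) \<in> V"
    using Q by (auto simp: quotient_basis_def)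
  obtain C where C: "\<And>y. y - (\<Sum>b\<in>Q. C y b *\<^sub>R b) \<in> V" using Qs by metis
  define p where "p y = (\<Sum>b\<in>Q. C y b *\<^sub>R b)" for y
  have zero: "\<forall>s\<in>S. c s = 0" if "(\<Sum>s\<in>S. c s *\<^sub>R p s) = 0" for c
  proof (rule S(2))
    have "(\<Sum>s\<in>S. c s *\<^sub>R (s - p s)) \<in> V"
      using C unfolding p_def by (intro subspace_sum[OF V] subspace_scale[OF V])
    then show "(\<Sum>s\<in>S. c s *\<^sub>R s) \<in> V"
      using that unfolding scaleR_right_diff_distrib sum_subtractf by simp
  qed
  have inj: "inj_on p S"
  proof (rule inj_onI, rule ccontr)
    fix s t assume st: "s \<in> S" "t \<in> S" "p s = p t" "s \<noteq> t"
    let ?c = "\<lambda>u. if u = s then 1 else if u = t then - 1 else (0::real)"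
    have "(\<Sum>u\<in>S. ?c u *\<^sub>R p u) = (\<Sum>u\<in>{s, t}. ?c u *\<^sub>R p u)"
      using st S(1) by (intro sum.mono_neutral_right) auto
    also have "\<dots> = 0" using st by simp
    finally have "?c s = 0" using zero[of ?c] st(1) by blast
    then show False by simp
  qed
  have "independent (p ` S)"
    unfolding dependent_finite[OF finite_imageI[OF S(1)]]
  proof clarify
    fix u s assume u: "u (p s) \<noteq> 0" "s \<in> S" "(\<Sum>v\<in>p ` S. u v *\<^sub>R v) = 0"
    have "(\<Sum>s\<in>S. u (p s) *\<^sub>R p s) = 0" using u(3) by (simp add: sum.reindex[OF inj])
    then show False using zero[of "\<lambda>s. u (p s)"] u by blast
  qed
  moreover have "p ` S \<subseteq> span Q"
    unfolding p_def by (intro image_subsetI span_sum span_scale span_base)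
  ultimately have "card (p ` S) \<le> card Q" using independent_span_bound[OF Qf] by blast
  then show ?thesis by (simp add: card_image[OF inj])
qed

lemma codim_eq_card:
  assumes V: "subspace V" and Q: "quotient_basis V Q"
  shows "codim V = card Q"
proof -
  let ?P = "SOME B. quotient_basis V B"
  have P: "quotient_basis V ?P" using Q by (rule someI)
  have le: "card B \<le> card C" if "quotient_basis V B" "quotient_basis V C" for B C
    using that(1) by (intro quotient_basis_card_le[OF V that(2)]) (simp_all add: quotient_basis_def)
  have "card ?P = card Q"
    using le[OF P Q] le[OF Q P] by (rule le_antisym)
  then show ?thesis using Q by (auto simp: codim_def finite_codimensional_def)
qed

lemma alternating_antisym:
  fixes \<beta> :: "'v::real_vector \<Rightarrow> 'v \<Rightarrow> real"
  assumes "bilinear \<beta>" "\<And>v. \<beta> v v = 0"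
  shows "\<beta> w v = - \<beta> v w"
  using assms(2)[of "v + w"] assms(2)[of v] assms(2)[of w]
  by (simp add: bilinear_ladd[OF assms(1)] bilinear_radd[OF assms(1)])

text \<open>Symplectic Gram-Schmidt: if \<beta> is not zero on \<open>span B\<close>, split off a
  hyperbolic plane. Its orthogonal complement has the same radical and a basis with two elements
  fewer.\<close>

lemma alternating_radical:
  fixes \<beta> :: "'v::real_vector \<Rightarrow> 'v \<Rightarrow> real"
  assumes bil: "bilinear \<beta>" and alt: "\<And>v. \<beta> v v = 0"
    and "finite B" "independent B"
  shows "\<exists>C. finite C \<and> independent C \<and> span C = {v \<in> span B. \<forall>w\<in>span B. \<beta> v w = 0} \<and>
    (even (card B) \<longleftrightarrow> even (card C))"
  using assms(3,4)
proof (induction "card B" arbitrary: B rule: less_induct)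
  case less
  note B = less.prems
  have anti: "\<beta> w v = - \<beta> v w" for v w by (rule alternating_antisym[OF bil alt])
  have lin: "linear (\<beta> v)" "linear (\<lambda>v. \<beta> v w)" for v w using bil by (auto simp: bilinear_def)
  have ext: "\<beta> v w = 0" if "\<And>b. b \<in> D \<Longrightarrow> \<beta> v b = 0" "w \<in> span D" for v w D
    using linear_eq_0_on_span[OF lin(1)] that by blast
  show ?case
  proof (cases "\<forall>a\<in>B. \<forall>b\<in>B. \<beta> a b = 0")
    case True
    have "\<beta> v w = 0" if "v \<in> span B" "w \<in> span B" for v w
    proof (rule ext[OF _ that(2)])
      fix b assume b: "b \<in> B"
      have "\<beta> b v = 0" using True b by (intro ext[OF _ that(1)]) simp
      then show "\<beta> v b = 0" using anti[of b v] by simp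
    qed
    then have "span B = {v \<in> span B. \<forall>w\<in>span B. \<beta> v w = 0}" by blast
    then show ?thesis using B by (intro exI[of _ B]) simp
  next
    case False
    then obtain a b where ab: "a \<in> B" "b \<in> B" "\<beta> a b \<noteq> 0" by blast
    define s where "s = \<beta> a b"
    have s: "s \<noteq> 0" "\<beta> a b = s" "\<beta> b a = - s" using ab anti[of a b] by (auto simp: s_def)
    have "a \<noteq> b" using ab(3) alt by auto
    \<comment> \<open>The projection along the plane of \<open>a\<close> and \<open>b\<close> onto
      its \<beta>-orthogonal complement; the signs come from
      \<open>\<beta> b a = - s\<close>.\<close>
    define p where "p v = v - (\<beta> v b / s) *\<^sub>R a + (\<beta> v a / s) *\<^sub>R b" for v
    have lp: "linear p"
      by (rule linearI) (simp_all add: p_def bilinear_ladd[OF bil] bilinear_lmul[OF bil]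
          add_divide_distrib scaleR_right_distrib scaleR_right_diff_distrib algebra_simps)
    note simps = bilinear_ladd[OF bil] bilinear_lsub[OF bil] bilinear_lmul[OF bil]
      bilinear_radd[OF bil] bilinear_rsub[OF bil] bilinear_rmul[OF bil] alt s
    have pb: "\<beta> (p v) b = 0" and pa: "\<beta> (p v) a = 0" for v
      using s by (simp_all add: p_def simps)
    have p0: "p a = 0" "p b = 0" using s by (simp_all add: p_def simps)
    let ?B0 = "B - {a, b}"
    have na: "a \<notin> span (B - {a})" and nb: "b \<notin> span (B - {b})"
      using B(2) ab unfolding dependent_def by blast+
    \<comment> \<open>The kernel of \<open>p\<close> consists of combinations of \<open>a\<close>
      and \<open>b\<close>, and by independence of \<open>B\<close> only 0 among them lies in
      \<open>span ?B0\<close>.\<close>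
    have inj: "inj_on p (span ?B0)"
    proof (rule inj_onI)
      fix v w assume vw: "v \<in> span ?B0" "w \<in> span ?B0" "p v = p w"
      define u where "u = v - w"
      have u: "u \<in> span ?B0" "p u = 0"
        using vw by (auto simp: u_def span_diff linear_diff[OF lp])
      define k l where "k = \<beta> u b / s" and "l = - \<beta> u a / s"
      have ukl: "u = k *\<^sub>R a + l *\<^sub>R b"
        using u(2) by (simp add: p_def k_def l_def algebra_simps)
      have u1: "u \<in> span (B - {a})" "u \<in> span (B - {b})"
        using u(1) span_mono[of ?B0 "B - {a}"] span_mono[of ?B0 "B - {b}"] by auto
      have "b \<in> span (B - {a})" "a \<in> span (B - {b})" using ab \<open>a \<noteq> b\<close> by (auto intro: span_base)
      then have "u - l *\<^sub>R b \<in> span (B - {a})" "u - k *\<^sub>R a \<in> span (B - {b})"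
        using u1 by (auto intro: span_diff span_scale)
      then have "k *\<^sub>R a \<in> span (B - {a})" "l *\<^sub>R b \<in> span (B - {b})" using ukl by simp_all
      then have "k = 0" "l = 0"
        using na nb span_scale[of "k *\<^sub>R a" "B - {a}" "inverse k"]
          span_scale[of "l *\<^sub>R b" "B - {b}" "inverse l"] by (cases "k = 0"; cases "l = 0"; simp)+
      then show "v = w" using ukl by (simp add: u_def)
    qed
    have B0: "finite ?B0" "independent ?B0"
      using B independent_mono[of B ?B0] by auto
    have ind: "independent (p ` ?B0)" using linear_independent_injective_image[OF lp B0(2) inj] .
    have "inj_on p ?B0" using inj span_superset by (rule inj_on_subset)
    then have "card (p ` ?B0) = card ?B0" by (rule card_image)
    moreover have "card ?B0 = card B - 2" "2 \<le> card B"
      using card_Diff_subset[of "{a, b}" B] card_mono[of B "{a, b}"] ab \<open>a \<noteq> b\<close> B(1) by simp_all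
    ultimately have c: "card B = card (p ` ?B0) + 2" by simp
    then have "card (p ` ?B0) < card B" by simp
    then obtain C where C: "finite C" "independent C"
      "span C = {v \<in> span (p ` ?B0). \<forall>w\<in>span (p ` ?B0). \<beta> v w = 0}"
      "even (card (p ` ?B0)) \<longleftrightarrow> even (card C)"
      using less.hyps[OF _ _ ind] B0(1) by blast
    have spB: "span (p ` ?B0) = p ` span B"
    proof -
      have "p ` B \<subseteq> insert 0 (p ` ?B0)" using p0 by auto
      then have "span (p ` B) \<subseteq> span (p ` ?B0)" using span_mono[of "p ` B"] span_insert_0 by blast
      moreover have "span (p ` ?B0) \<subseteq> span (p ` B)" by (intro span_mono) blast
      ultimately show ?thesis using linear_span_image[OF lp, of B] by blast
    qed
    have "a \<in> span B" "b \<in> span B" using ab by (auto intro: span_base)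
    then have pB: "p v \<in> span B" if "v \<in> span B" for v
      unfolding p_def using that by (intro span_add span_diff span_scale)
    \<comment> \<open>Each \<open>w\<close> differs from \<open>p w\<close> by a combination of
      \<open>a\<close> and \<open>b\<close>, to which every \<open>p v\<close> is orthogonal;
      conversely, \<open>p\<close> fixes the radical.\<close>
    have "{v \<in> span (p ` ?B0). \<forall>w\<in>span (p ` ?B0). \<beta> v w = 0} = {v \<in> span B. \<forall>w\<in>span B. \<beta> v w = 0}"
    proof (intro subset_antisym subsetI)
      fix v assume "v \<in> {v \<in> span (p ` ?B0). \<forall>w\<in>span (p ` ?B0). \<beta> v w = 0}"
      then obtain v0 where v0: "v0 \<in> span B" "v = p v0" and v: "\<And>w. w \<in> span B \<Longrightarrow> \<beta> v (p w) = 0"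
        unfolding spB by blast
      have "\<beta> v w = 0" if "w \<in> span B" for w
        using v[OF that] pa[of v0] pb[of v0] v0(2) by (simp add: p_def[of w] simps)
      then show "v \<in> {v \<in> span B. \<forall>w\<in>span B. \<beta> v w = 0}" using v0 pB by blast
    next
      fix v assume "v \<in> {v \<in> span B. \<forall>w\<in>span B. \<beta> v w = 0}"
      then have v: "v \<in> span B" "\<And>w. w \<in> span B \<Longrightarrow> \<beta> v w = 0" by blast+
      have "\<beta> v a = 0" "\<beta> v b = 0" using v ab span_base by blast+
      then have "p v = v" by (simp add: p_def)
      then have "v \<in> span (p ` ?B0)" unfolding spB using imageI[OF v(1), of p] by simp
      moreover have "\<beta> v w = 0" if "w \<in> span (p ` ?B0)" for w
        using that v(2) pB unfolding spB by blast
      ultimately show "v \<in> {v \<in> span (p ` ?B0). \<forall>w\<in>span (p ` ?B0). \<beta> v w = 0}" by blast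
    qed
    then have "span C = {v \<in> span B. \<forall>w\<in>span B. \<beta> v w = 0}" using C(3) by simp
    moreover have "even (card B) \<longleftrightarrow> even (card C)" using C(4) c by simp
    ultimately show ?thesis using C(1,2) by (intro exI[of _ C]) simp
  qed
qed

subsection \<open>Skew-adjoint relations as Lagrangian subspaces\<close>

locale nondegenerate_pairing = bounded_bilinear \<Omega>
  for \<Omega> :: "'x::banach \<Rightarrow> 'y::banach \<Rightarrow> real" +
  assumes nondegenerate: "nondegenerate \<Omega>"
begin

lemma eq_0_left: "(\<And>y. \<Omega> x y = 0) \<Longrightarrow> x = 0"
  and eq_0_right: "(\<And>x. \<Omega> x y = 0) \<Longrightarrow> y = 0"
  using nondegenerate by (auto simp: nondegenerate_def)

definition form :: "'x \<times> 'y \<Rightarrow> 'x \<times> 'y \<Rightarrow> real" where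
  "form z w = \<Omega> (fst z) (snd w) + \<Omega> (fst w) (snd z)"

definition lagrangian :: "('x \<times> 'y) set \<Rightarrow> bool" where
  "lagrangian T \<longleftrightarrow> T = {w. \<forall>z\<in>T. form z w = 0}"

lemma form_commute: "form z w = form w z"
  by (simp add: form_def)

lemma form_linear: "form z (w + w') = form z w + form z w'" "form (w + w') z = form w z + form w' z"
  "form z (w - w') = form z w - form z w'" "form (w - w') z = form w z - form w' z"
  "form z (c *\<^sub>R w) = c * form z w" "form (c *\<^sub>R w) z = c * form w z" "form 0 z = 0" "form z 0 = 0"
  by (simp_all add: form_def add_left add_right diff_left diff_right scaleR_left scaleR_right
      zero_left zero_right algebra_simps)

lemma form_nondegenerate:
  assumes "\<And>w. form z w = 0"
  shows "z = 0"
proof -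
  have "\<Omega> (fst z) y = 0" for y
    using assms[of "(0, y)"] by (simp add: form_def zero_left)
  moreover have "\<Omega> x (snd z) = 0" for x
    using assms[of "(x, 0)"] by (simp add: form_def zero_right)
  ultimately show ?thesis
    using eq_0_left eq_0_right by (simp add: prod_eq_iff)
qed

lemma lagrangian_isotropic: "lagrangian T \<Longrightarrow> z \<in> T \<Longrightarrow> w \<in> T \<Longrightarrow> form z w = 0"
  unfolding lagrangian_def by blast

lemma lagrangianD: "lagrangian T \<Longrightarrow> (\<And>z. z \<in> T \<Longrightarrow> form z w = 0) \<Longrightarrow> w \<in> T"
  unfolding lagrangian_def by blast

lemma lagrangianI:
  "(\<And>z w. z \<in> T \<Longrightarrow> w \<in> T \<Longrightarrow> form z w = 0) \<Longrightarrow> (\<And>w. (\<And>z. z \<in> T \<Longrightarrow> form z w = 0) \<Longrightarrow> w \<in> T)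
    \<Longrightarrow> lagrangian T"
  unfolding lagrangian_def by blast

text \<open>The sign in skew-adjointness is absorbed by passing from \<open>y\<close> to
  \<open>- y\<close>, which turns the adjoint equation into orthogonality for
  \<open>form\<close>.\<close>

lemma skew_adjoint_iff_lagrangian: "skew_adjoint \<Omega> T \<longleftrightarrow> lagrangian T"
proof -
  have 1: "(x, y) \<in> {(x, - y) |x y. (x, y) \<in> T} \<longleftrightarrow> (x, - y) \<in> T" for x y
  proof
    assume "(x, - y) \<in> T"
    then have "(x, - (- y)) \<in> {(x, - y) |x y. (x, y) \<in> T}" by blast
    then show "(x, y) \<in> {(x, - y) |x y. (x, y) \<in> T}" by simp
  qed auto
  have 2: "(x, y) \<in> rel_adjoint \<Omega> T \<longleftrightarrow> (\<forall>z\<in>T. form z (x, - y) = 0)" for x y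
  proof -
    have "(\<Omega> (fst z) y = \<Omega> x (snd z)) = (form z (x, - y) = 0)" for z
      by (auto simp: form_def minus_right)
    then show ?thesis by (simp add: rel_adjoint_def case_prod_beta)
  qed
  have "skew_adjoint \<Omega> T \<longleftrightarrow> (\<forall>x y. (x, - y) \<in> T \<longleftrightarrow> (\<forall>z\<in>T. form z (x, - y) = 0))"
    unfolding skew_adjoint_def set_eq_iff split_paired_All 1 2 ..
  also have "\<dots> \<longleftrightarrow> (\<forall>x y. (x, y) \<in> T \<longleftrightarrow> (\<forall>z\<in>T. form z (x, y) = 0))"
  proof
    assume *: "\<forall>x y. (x, - y) \<in> T \<longleftrightarrow> (\<forall>z\<in>T. form z (x, - y) = 0)"
    show "\<forall>x y. (x, y) \<in> T \<longleftrightarrow> (\<forall>z\<in>T. form z (x, y) = 0)"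
    proof (intro allI)
      fix x y
      have "(x, - (- y)) \<in> T \<longleftrightarrow> (\<forall>z\<in>T. form z (x, - (- y)) = 0)" using * by blast
      then show "(x, y) \<in> T \<longleftrightarrow> (\<forall>z\<in>T. form z (x, y) = 0)" unfolding minus_minus .
    qed
  qed blast
  finally show ?thesis unfolding lagrangian_def set_eq_iff split_paired_All mem_Collect_eq .
qed

lemma lagrangian_subspace:
  assumes "lagrangian T"
  shows "subspace T"
proof -
  have "subspace {w. \<forall>z\<in>T. form z w = 0}"
    by (simp add: subspace_def form_linear)
  then show ?thesis by (subst assms[unfolded lagrangian_def])
qed

lemma lagrangian_closed:
  assumes "lagrangian T"
  shows "closed T"
proof -
  have "closed {w. form z w = 0}" for z
    unfolding form_def
    by (intro closed_Collect_eq continuous_intros bounded_linear.continuous_on[OF bounded_linear_right]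
        bounded_linear.continuous_on[OF bounded_linear_left])
  then have "closed (\<Inter>z\<in>T. {w. form z w = 0})" by blast
  moreover have "(\<Inter>z\<in>T. {w. form z w = 0}) = {w. \<forall>z\<in>T. form z w = 0}" by blast
  ultimately show ?thesis by (subst assms[unfolded lagrangian_def]) simp
qed

section \<open>Finite dual systems, their projections and annihilators\<close>

definition annihilator :: "'x set \<Rightarrow> 'y set" where
  "annihilator B = {y. \<forall>b\<in>B. \<Omega> b y = 0}"

lemma annihilator_span: "x \<in> span B \<Longrightarrow> y \<in> annihilator B \<Longrightarrow> \<Omega> x y = 0"
  by (induction rule: span_induct_alt) (auto simp: annihilator_def zero_left add_left scaleR_left)

lemma subspace_annihilator: "subspace (annihilator B)"
  by (simp add: annihilator_def subspace_def add_right scaleR_right zero_right)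

lemma closed_annihilator: "closed (annihilator B)"
proof -
  have "closed (\<Inter>b\<in>B. {y. \<Omega> b y = 0})"
    by (intro closed_INT ballI closed_Collect_eq continuous_on_const linear_continuous_on bounded_linear_right)
  moreover have "(\<Inter>b\<in>B. {y. \<Omega> b y = 0}) = annihilator B" by (auto simp: annihilator_def)
  ultimately show ?thesis by simp
qed

text \<open>A finite biorthogonal system. It plays the part of Hahn-Banach functionals, with every
  functional represented by a vector of \<open>Y\<close>.\<close>

definition dual_system :: "'x set \<Rightarrow> ('x \<Rightarrow> 'y) \<Rightarrow> bool" where
  "dual_system B g \<longleftrightarrow> finite B \<and> (\<forall>b\<in>B. \<forall>c\<in>B. \<Omega> b (g c) = (if b = c then 1 else 0))"

lemma dual_system_sum_left:
  assumes "dual_system B g" "c \<in> B"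
  shows "\<Omega> (\<Sum>b\<in>B. u b *\<^sub>R b) (g c) = u c"
proof -
  have "\<Omega> (\<Sum>b\<in>B. u b *\<^sub>R b) (g c) = (\<Sum>b\<in>B. if b = c then u b else 0)"
    using assms unfolding sum_left scaleR_left by (intro sum.cong) (auto simp: dual_system_def)
  then show ?thesis using assms by (simp add: dual_system_def)
qed

lemma dual_system_sum_right:
  assumes "dual_system B g" "b \<in> B"
  shows "\<Omega> b (\<Sum>c\<in>B. u c *\<^sub>R g c) = u b"
proof -
  have "\<Omega> b (\<Sum>c\<in>B. u c *\<^sub>R g c) = (\<Sum>c\<in>B. if b = c then u c else 0)"
    using assms unfolding sum_right scaleR_right by (intro sum.cong) (auto simp: dual_system_def)
  then show ?thesis using assms by (simp add: dual_system_def)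
qed

lemma dual_system_independent:
  assumes "dual_system B g"
  shows "independent B"
proof -
  have "finite B" using assms by (simp add: dual_system_def)
  then show ?thesis
    unfolding dependent_finite[OF \<open>finite B\<close>]
  proof clarify
    fix u b assume "b \<in> B" "u b \<noteq> 0" "(\<Sum>v\<in>B. u v *\<^sub>R v) = 0"
    then show False using dual_system_sum_left[OF assms, of b u] by (simp add: zero_left)
  qed
qed

text \<open>Biorthogonal Gram-Schmidt: \<open>?a\<close> is the part of \<open>a\<close> that pairs
  to zero with the old \<open>g b\<close>, and non-degeneracy yields a partner for it.\<close>

lemma dual_system_exists:
  assumes "finite B" "independent B"
  shows "\<exists>g. dual_system B g"
  using assms
proof (induction B rule: finite_induct)
  case empty
  then show ?case by (simp add: dual_system_def)
next
  case (insert a B)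
  then obtain g where g: "dual_system B g" and a: "a \<notin> span B"
    by (auto simp: independent_insert)
  have fin: "finite B" by fact
  let ?a = "a - (\<Sum>b\<in>B. \<Omega> a (g b) *\<^sub>R b)"
  have "?a \<noteq> 0"
  proof
    assume "?a = 0"
    then have "a = (\<Sum>b\<in>B. \<Omega> a (g b) *\<^sub>R b)" by simp
    also have "\<dots> \<in> span B" by (intro span_sum span_scale span_base)
    finally show False using a by simp
  qed
  then obtain y where y: "\<Omega> ?a y \<noteq> 0" using eq_0_left by blast
  define y1 where "y1 = y /\<^sub>R \<Omega> ?a y"
  have y1: "\<Omega> ?a y1 = 1" using y by (simp add: y1_def scaleR_right)
  define y2 where "y2 = y1 - (\<Sum>b\<in>B. \<Omega> b y1 *\<^sub>R g b)"
  \<comment> \<open>Both corrections subtract the same sum of products, so normalising against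
    \<open>?a\<close> also normalises \<open>y2\<close> against \<open>a\<close>.\<close>
  have "\<Omega> a y2 = \<Omega> ?a y1"
    by (simp add: y2_def diff_left diff_right sum_left sum_right scaleR_left scaleR_right mult.commute)
  then have ay2: "\<Omega> a y2 = 1" using y1 by simp
  have by2: "\<Omega> b y2 = 0" if "b \<in> B" for b
    using dual_system_sum_right[OF g that] by (simp add: y2_def diff_right)
  define h where "h b = (if b = a then y2 else g b - \<Omega> a (g b) *\<^sub>R y2)" for b
  have "dual_system (insert a B) h"
    unfolding dual_system_def
  proof (intro conjI ballI)
    fix b c assume bc: "b \<in> insert a B" "c \<in> insert a B"
    then show "\<Omega> b (h c) = (if b = c then 1 else 0)"
      using g insert.hyps ay2 by2 by (auto simp: h_def dual_system_def diff_right scaleR_right)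
  qed (use fin in simp)
  then show ?case by blast
qed

definition proj_left :: "'x set \<Rightarrow> ('x \<Rightarrow> 'y) \<Rightarrow> 'x \<Rightarrow> 'x" where
  "proj_left B g x = (\<Sum>b\<in>B. \<Omega> x (g b) *\<^sub>R b)"

definition proj_right :: "'x set \<Rightarrow> ('x \<Rightarrow> 'y) \<Rightarrow> 'y \<Rightarrow> 'y" where
  "proj_right B g y = (\<Sum>b\<in>B. \<Omega> b y *\<^sub>R g b)"

lemma proj_left_in_span: "proj_left B g x \<in> span B"
  unfolding proj_left_def by (intro span_sum span_scale span_base)

lemma pair_proj_left: "dual_system B g \<Longrightarrow> b \<in> B \<Longrightarrow> \<Omega> (proj_left B g x) (g b) = \<Omega> x (g b)"
  unfolding proj_left_def by (rule dual_system_sum_left)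

lemma pair_proj_right: "dual_system B g \<Longrightarrow> b \<in> B \<Longrightarrow> \<Omega> b (proj_right B g y) = \<Omega> b y"
  unfolding proj_right_def by (rule dual_system_sum_right)

lemma diff_proj_right_in_annihilator: "dual_system B g \<Longrightarrow> y - proj_right B g y \<in> annihilator B"
  by (simp add: annihilator_def diff_right pair_proj_right)

lemma bounded_linear_proj_left: "bounded_linear (proj_left B g)"
  unfolding proj_left_def
  by (intro bounded_linear_sum bounded_linear_scaleR_const bounded_linear_left)

lemma bounded_linear_proj_right: "bounded_linear (proj_right B g)"
  unfolding proj_right_def
  by (intro bounded_linear_sum bounded_linear_scaleR_const bounded_linear_right)

lemma span_eq_0:
  assumes d: "dual_system B g" and x: "x \<in> span B" and 0: "\<And>b. b \<in> B \<Longrightarrow> \<Omega> x (g b) = 0"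
  shows "x = 0"
proof -
  have "finite B" using d by (simp add: dual_system_def)
  then obtain u where u: "x = (\<Sum>b\<in>B. u b *\<^sub>R b)"
    using x by (auto simp: span_finite)
  have "u b = 0" if "b \<in> B" for b
    using 0[OF that] dual_system_sum_left[OF d that, of u] u by simp
  then show ?thesis using u by simp
qed

lemma proj_left_of_span:
  assumes "dual_system B g" "x \<in> span B"
  shows "proj_left B g x = x"
  using span_eq_0[OF assms(1), of "x - proj_left B g x"] assms pair_proj_left[OF assms(1)]
  by (simp add: span_diff proj_left_in_span diff_left)

text \<open>The remainder \<open>x - proj_left B g x\<close> pairs to zero with both parts of the
  decomposition of \<open>y\<close> given by \<open>proj_right\<close>, so non-degeneracy kills
  it.\<close>

lemma double_annihilator:
  assumes d: "dual_system B g" and x: "\<And>y. y \<in> annihilator B \<Longrightarrow> \<Omega> x y = 0"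
  shows "x \<in> span B"
proof -
  have "\<Omega> (x - proj_left B g x) y = 0" for y
  proof -
    have "\<Omega> (x - proj_left B g x) (y - proj_right B g y) = 0"
      using x diff_proj_right_in_annihilator[OF d] annihilator_span[OF proj_left_in_span]
      by (simp add: diff_left)
    moreover have "\<Omega> (x - proj_left B g x) (proj_right B g y) = 0"
      using pair_proj_left[OF d] by (simp add: proj_right_def sum_right scaleR_right diff_left)
    ultimately show ?thesis by (simp add: diff_right)
  qed
  then have "x = proj_left B g x" using eq_0_left[of "x - proj_left B g x"] by simp
  then show ?thesis using proj_left_in_span by metis
qed

lemma quotient_basis_annihilator:
  assumes "dual_system B g"
  shows "quotient_basis (annihilator B) (g ` B)" "card (g ` B) = card B"
proof -
  have inj: "inj_on g B"
    using assms unfolding dual_system_def inj_on_def by (metis zero_neq_one)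
  show "card (g ` B) = card B" using inj by (rule card_image)
  show "quotient_basis (annihilator B) (g ` B)"
    unfolding quotient_basis_def sum.reindex[OF inj] o_def
  proof (intro conjI allI impI ballI)
    show "finite (g ` B)" using assms by (simp add: dual_system_def)
  next
    fix c v assume "(\<Sum>x\<in>B. c (g x) *\<^sub>R g x) \<in> annihilator B" "v \<in> g ` B"
    then show "c v = 0"
      using dual_system_sum_right[OF assms, of _ "\<lambda>x. c (g x)"] by (auto simp: annihilator_def)
  next
    fix y
    have "(\<Sum>x\<in>B. \<Omega> (inv_into B g (g x)) y *\<^sub>R g x) = proj_right B g y"
      unfolding proj_right_def using inj by (intro sum.cong) auto
    then show "\<exists>c. y - (\<Sum>x\<in>B. c (g x) *\<^sub>R g x) \<in> annihilator B"
      using diff_proj_right_in_annihilator[OF assms, of y]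
      by (intro exI[of _ "\<lambda>v. \<Omega> (inv_into B g v) y"]) simp
  qed
qed

text \<open>The working form of membership in \<open>FR0_sa\<close>. Equality of the range with the
  full annihilator encodes index 0; \<open>B\<close> and \<open>g\<close> are auxiliary
  choices.\<close>

definition adapted :: "('x \<times> 'y) set \<Rightarrow> 'x set \<Rightarrow> ('x \<Rightarrow> 'y) \<Rightarrow> bool" where
  "adapted T B g \<longleftrightarrow> lagrangian T \<and> dual_system B g \<and> rel_ker T = span B \<and> Range T = annihilator B"

lemma adapted_FR0:
  assumes "adapted T B g"
  shows "T \<in> FR0_sa \<Omega>" "dim (rel_ker T) = card B"
proof -
  have T: "lagrangian T" "dual_system B g" "rel_ker T = span B" "Range T = annihilator B"
    using assms by (auto simp: adapted_def)
  show d: "dim (rel_ker T) = card B"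
    unfolding T(3) dim_span using dual_system_independent[OF T(2)] by (rule dim_eq_card_independent)
  have "finite B" using T(2) by (simp add: dual_system_def)
  then have 1: "finite_dimensional (rel_ker T)"
    unfolding finite_dimensional_def T(3) by blast
  have 2: "finite_codimensional (Range T)"
    unfolding finite_codimensional_def T(4) using quotient_basis_annihilator(1)[OF T(2)] by blast
  have 3: "codim (Range T) = card B"
    unfolding T(4) codim_eq_card[OF subspace_annihilator quotient_basis_annihilator(1)[OF T(2)]]
    by (rule quotient_basis_annihilator(2)[OF T(2)])
  have 4: "closed (Range T)" unfolding T(4) by (rule closed_annihilator)
  have 5: "skew_adjoint \<Omega> T" unfolding skew_adjoint_iff_lagrangian by (rule T(1))
  show "T \<in> FR0_sa \<Omega>"
    unfolding FR0_sa_def fredholm_relation_def fredholm_index_def mem_Collect_eq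
    using 1 2 3 4 5 d lagrangian_subspace[OF T(1)] lagrangian_closed[OF T(1)] by (intro conjI) simp_all
qed

lemma FR0_adapted:
  assumes "T \<in> FR0_sa \<Omega>"
  obtains B g where "adapted T B g"
proof -
  have T: "lagrangian T" "finite_dimensional (rel_ker T)" "finite_codimensional (Range T)"
      "codim (Range T) = dim (rel_ker T)"
    using assms by (auto simp: FR0_sa_def fredholm_relation_def fredholm_index_def skew_adjoint_iff_lagrangian)
  note sub = lagrangian_subspace[OF T(1)]
  have subK: "subspace (rel_ker T)"
    using subspace_0[OF sub] subspace_add[OF sub, of "(x, 0)" "(y, 0)" for x y] subspace_scale[OF sub, of "(x, 0)" for x]
    by (simp add: subspace_def rel_ker_def zero_prod_def)
  have subR: "subspace (Range T)"
    using linear_subspace_image[OF linear_snd sub] by (simp add: Range_snd)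
  obtain B where B: "B \<subseteq> rel_ker T" "independent B" "rel_ker T \<subseteq> span B" "card B = dim (rel_ker T)"
    using basis_exists by blast
  have sB: "rel_ker T = span B" using B subK by (simp add: span_minimal subset_antisym)
  have fB: "finite B"
    using T(2) B independent_span_bound unfolding finite_dimensional_def by metis
  obtain g where g: "dual_system B g" using dual_system_exists fB B by blast
  have R1: "Range T \<subseteq> annihilator B"
  proof
    fix y assume "y \<in> Range T"
    then obtain x where x: "(x, y) \<in> T" by blast
    have "\<Omega> b y = 0" if "b \<in> B" for b
    proof -
      have "(b, 0) \<in> T" using B that by (auto simp: rel_ker_def)
      then show ?thesis using lagrangian_isotropic[OF T(1) _ x, of "(b, 0)"] by (simp add: form_def zero_right)
    qed
    then show "y \<in> annihilator B" by (simp add: annihilator_def)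
  qed
  obtain Q where Q: "quotient_basis (Range T) Q" using T by (auto simp: finite_codimensional_def)
  have cQ: "card Q = card B" using codim_eq_card[OF subR Q] T B by simp
  have "annihilator B \<subseteq> Range T"
  proof (rule ccontr)
    assume "\<not> ?thesis"
    then obtain y where y: "y \<in> annihilator B" "y \<notin> Range T" by blast
    note qb = quotient_basis_annihilator[OF g]
    have fin: "finite (g ` B)" using fB by simp
    have ind: "\<forall>s\<in>g ` B. c s = 0" if "(\<Sum>s\<in>g ` B. c s *\<^sub>R s) \<in> annihilator B" for c
      using qb(1) that by (auto simp: quotient_basis_def)
    have yB: "y \<notin> g ` B"
    proof
      assume "y \<in> g ` B"
      then have "(\<Sum>s\<in>g ` B. (if s = y then 1 else 0) *\<^sub>R s) = y"
        using fin by (simp add: if_distrib[of "\<lambda>c. c *\<^sub>R _"] sum.delta cong: if_cong)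
      then show False using ind[of "\<lambda>s. if s = y then 1 else 0"] y(1) \<open>y \<in> g ` B\<close> by auto
    qed
    have "card (insert y (g ` B)) \<le> card Q"
    proof (rule quotient_basis_card_le[OF subR Q])
      fix c assume c: "(\<Sum>s\<in>insert y (g ` B). c s *\<^sub>R s) \<in> Range T"
      then have *: "c y *\<^sub>R y + (\<Sum>s\<in>g ` B. c s *\<^sub>R s) \<in> Range T" using fin yB by simp
      \<comment> \<open>Modulo the larger space \<open>annihilator B\<close> the term with
        \<open>y\<close> vanishes, so the other coefficients are zero first.\<close>
      then have "(c y *\<^sub>R y + (\<Sum>s\<in>g ` B. c s *\<^sub>R s)) - c y *\<^sub>R y \<in> annihilator B"
        using R1 y(1) by (intro subspace_diff subspace_scale subspace_annihilator) auto
      then have z: "\<forall>s\<in>g ` B. c s = 0" using ind by simp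
      then have "(\<Sum>s\<in>g ` B. c s *\<^sub>R s) = 0" by (intro sum.neutral) simp
      then have "c y *\<^sub>R y \<in> Range T" using * by simp
      then have "c y = 0" using y(2) subspace_scale[OF subR, of "c y *\<^sub>R y" "inverse (c y)"] by fastforce
      then show "\<forall>s\<in>insert y (g ` B). c s = 0" using z by simp
    qed (use fin in simp)
    then show False using cQ qb(2) yB fin by simp
  qed
  then have "adapted T B g" using R1 T g sB by (auto simp: adapted_def)
  then show ?thesis by (rule that)
qed

subsection \<open>Paths of shears\<close>

text \<open>A Lagrangian is maximal isotropic. Later identifications of sheared relations therefore
  check one inclusion only.\<close>

lemma lagrangian_subset_imp_eq:
  assumes "lagrangian S" "lagrangian T" "S \<subseteq> T"
  shows "S = T"
  using assms lagrangianD[OF assms(1)] lagrangian_isotropic[OF assms(2)] by blast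

text \<open>Since \<open>N\<close> has square zero, \<open>1 + t N\<close> is \<open>exp (t N)\<close>, an isometry of the form.\<close>

definition infinitesimal_isometry :: "('x \<times> 'y \<Rightarrow> 'x \<times> 'y) \<Rightarrow> bool" where
  "infinitesimal_isometry N \<longleftrightarrow> bounded_linear N \<and> (\<forall>z. N (N z) = 0) \<and>
     (\<forall>z w. form (N z) w + form z (N w) = 0)"

definition shear :: "('x \<times> 'y \<Rightarrow> 'x \<times> 'y) \<Rightarrow> real \<Rightarrow> ('x \<times> 'y) set \<Rightarrow> ('x \<times> 'y) set" where
  "shear N t T = (\<lambda>z. z + t *\<^sub>R N z) ` T"

lemma shear_0 [simp]: "shear N 0 T = T"
  by (simp add: shear_def)

text \<open>\<open>1 - t N\<close> is both the inverse and the adjoint of \<open>1 + t N\<close>, so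
  orthogonality to the sheared space pulls back to \<open>T\<close>.\<close>

lemma lagrangian_shear:
  assumes N: "infinitesimal_isometry N" and T: "lagrangian T"
  shows "lagrangian (shear N t T)"
proof -
  have lin: "linear N" and NN: "\<And>z. N (N z) = 0" and sk: "\<And>z w. form (N z) w = - form z (N w)"
    using N unfolding infinitesimal_isometry_def
    by (blast dest: bounded_linear.linear, blast, metis eq_neg_iff_add_eq_0)
  interpret linear N by fact
  have iso: "form (z + s *\<^sub>R N z) w = form z (w - s *\<^sub>R N w)" for z w s
    by (simp add: form_linear sk)
  have inv: "(z + s *\<^sub>R N z) - s *\<^sub>R N (z + s *\<^sub>R N z) = z"
    "(z - s *\<^sub>R N z) + s *\<^sub>R N (z - s *\<^sub>R N z) = z" for z s
    by (simp_all add: add diff scale NN)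
  show ?thesis
  proof (rule lagrangianI)
    fix z w assume "z \<in> shear N t T" "w \<in> shear N t T"
    then obtain z' w' where zw: "z' \<in> T" "w' \<in> T" "z = z' + t *\<^sub>R N z'" "w = w' + t *\<^sub>R N w'"
      by (auto simp: shear_def)
    show "form z w = 0"
      unfolding zw(3) iso unfolding zw(4) inv using lagrangian_isotropic[OF T zw(1,2)] .
  next
    fix w assume *: "\<And>z. z \<in> shear N t T \<Longrightarrow> form z w = 0"
    have "w - t *\<^sub>R N w \<in> T"
    proof (rule lagrangianD[OF T])
      fix z assume "z \<in> T"
      then show "form z (w - t *\<^sub>R N w) = 0"
        using * unfolding iso[symmetric] by (simp add: shear_def)
    qed
    then have "(w - t *\<^sub>R N w) + t *\<^sub>R N (w - t *\<^sub>R N w) \<in> shear N t T"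
      unfolding shear_def by blast
    then show "w \<in> shear N t T" unfolding inv .
  qed
qed

text \<open>For \<open>u = z + t *\<^sub>R N z\<close>, square zero gives \<open>N u = N z\<close>.
  The displacement is thus bounded by \<open>norm u\<close> itself, with a constant independent of
  the base parameter.\<close>

lemma gap_shear_le:
  assumes N: "infinitesimal_isometry N" and T: "subspace T" and K: "\<And>z. norm (N z) \<le> K * norm z" "K \<ge> 0"
  shows "gap (shear N t T) (shear N s T) \<le> \<bar>s - t\<bar> * K"
proof -
  have lin: "linear N" and NN: "\<And>z. N (N z) = 0"
    using N unfolding infinitesimal_isometry_def by (blast dest: bounded_linear.linear, blast)
  interpret linear N by fact
  have "linear (\<lambda>z. z + t *\<^sub>R N z)" for t
    by (intro linear_compose_add linear_id[unfolded id_def] linear_compose_scale_right lin)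
  then have sub: "subspace (shear N t T)" for t
    unfolding shear_def using T by (rule linear_subspace_image)
  have *: "gap_delta (shear N t T) (shear N s T) \<le> \<bar>s - t\<bar> * K" for s t
  proof (rule gap_delta_le[OF sub])
    show "0 \<le> \<bar>s - t\<bar> * K" using K by simp
  next
    fix u assume "u \<in> shear N t T"
    then obtain z where z: "z \<in> T" "u = z + t *\<^sub>R N z" by (auto simp: shear_def)
    have "N u = N z" by (simp add: z(2) add scale NN)
    then have "u - (z + s *\<^sub>R N z) = (t - s) *\<^sub>R N u" by (simp add: z(2) algebra_simps)
    then have "norm (u - (z + s *\<^sub>R N z)) = \<bar>s - t\<bar> * norm (N u)"
      by (simp add: abs_minus_commute)
    also have "\<dots> \<le> \<bar>s - t\<bar> * (K * norm u)" using K by (intro mult_left_mono) auto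
    finally have "norm (u - (z + s *\<^sub>R N z)) \<le> \<bar>s - t\<bar> * K * norm u" by (simp only: mult.assoc)
    moreover have "z + s *\<^sub>R N z \<in> shear N s T" using z unfolding shear_def by blast
    ultimately show "\<exists>v\<in>shear N s T. norm (u - v) \<le> \<bar>s - t\<bar> * K * norm u" by blast
  qed
  show ?thesis using *[of t s] *[of s t] by (simp add: gap_def abs_minus_commute)
qed

lemma path_component_shear:
  assumes N: "infinitesimal_isometry N" and FR: "\<And>t. shear N t T \<in> FR0_sa \<Omega>"
  shows "path_component_of (FR0_sa_space \<Omega>) T (shear N 1 T)"
proof -
  have T: "T \<in> FR0_sa \<Omega>" using FR[of 0] by simp
  have cs: "shear N t T \<in> closed_subspaces" for t
    using FR[of t] by (auto simp: FR0_sa_def fredholm_relation_def closed_subspaces_def)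
  have sub: "subspace T" using cs[of 0] by (simp add: closed_subspaces_def)
  have "bounded_linear N" using N by (simp add: infinitesimal_isometry_def)
  then obtain K where "K > 0" and "\<forall>z. norm (N z) \<le> norm z * K"
    using bounded_linear.pos_bounded by blast
  then have K: "norm (N z) \<le> K * norm z" for z unfolding mult.commute[of K] by blast
  have "continuous_map (top_of_set {0..1}) gap_topology (\<lambda>t. shear N t T)"
    unfolding continuous_map_def
  proof (intro conjI allI impI)
    show "(\<lambda>t. shear N t T) \<in> topspace (top_of_set {0..1}) \<rightarrow> topspace gap_topology"
      using cs by (simp add: topspace_gap_topology)
  next
    fix U :: "('x \<times> 'y) set set" assume U: "openin gap_topology U"
    show "openin (top_of_set {0..1}) {t \<in> topspace (top_of_set {0..1}). shear N t T \<in> U}"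
      unfolding openin_euclidean_subtopology_iff
    proof (intro conjI ballI)
      fix t assume "t \<in> {t \<in> topspace (top_of_set {0..1}). shear N t T \<in> U}"
      then have "shear N t T \<in> U" by simp
      then obtain e where e: "e > 0" "\<And>M. M \<in> closed_subspaces \<Longrightarrow> gap (shear N t T) M < e \<Longrightarrow> M \<in> U"
        using U unfolding openin_gap_topology by blast
      show "\<exists>d>0. \<forall>s\<in>{0..1}. dist s t < d \<longrightarrow> s \<in> {t \<in> topspace (top_of_set {0..1}). shear N t T \<in> U}"
      proof (intro exI[of _ "e / K"] conjI ballI impI)
        show "e / K > 0" using \<open>K > 0\<close> e by simp
      next
        fix s :: real assume s: "s \<in> {0..1}" "dist s t < e / K"
        have "gap (shear N t T) (shear N s T) \<le> \<bar>s - t\<bar> * K"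
          using gap_shear_le[OF N sub K] \<open>K > 0\<close> by simp
        also have "\<dots> < e" using s \<open>K > 0\<close> by (simp add: dist_real_def pos_less_divide_eq)
        finally have "shear N s T \<in> U" using e(2)[OF cs] by blast
        then show "s \<in> {t \<in> topspace (top_of_set {0..1}). shear N t T \<in> U}" using s by simp
      qed
    qed auto
  qed
  then have "pathin (FR0_sa_space \<Omega>) (\<lambda>t. shear N t T)"
    unfolding pathin_def FR0_sa_space_def continuous_map_in_subtopology using FR by auto
  then show ?thesis unfolding path_component_of_def by (intro exI[of _ "\<lambda>t. shear N t T"]) simp
qed

section \<open>Paths to a normal form\<close>

lemma adapted_span_annihilator:
  assumes d: "dual_system B g"
  shows "adapted (span B \<times> annihilator B) B g"
proof -
  have 0: "0 \<in> span B" "0 \<in> annihilator B" by (auto simp: span_zero subspace_0[OF subspace_annihilator])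
  have "lagrangian (span B \<times> annihilator B)"
  proof (rule lagrangianI)
    fix z w assume "z \<in> span B \<times> annihilator B" "w \<in> span B \<times> annihilator B"
    then show "form z w = 0" by (auto simp: form_def annihilator_span)
  next
    fix w assume w: "\<And>z. z \<in> span B \<times> annihilator B \<Longrightarrow> form z w = 0"
    have "fst w \<in> span B"
    proof (rule double_annihilator[OF d])
      fix y assume "y \<in> annihilator B"
      then show "\<Omega> (fst w) y = 0" using w[of "(0, y)"] 0 by (simp add: form_def zero_left)
    qed
    moreover have "snd w \<in> annihilator B"
      unfolding annihilator_def
    proof (intro CollectI ballI)
      fix b assume "b \<in> B"
      then show "\<Omega> b (snd w) = 0" using w[of "(b, 0)"] 0 by (simp add: form_def zero_right span_base)
    qed
    ultimately show "w \<in> span B \<times> annihilator B" by (simp add: mem_Times_iff)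
  qed
  moreover have "rel_ker (span B \<times> annihilator B) = span B" "Range (span B \<times> annihilator B) = annihilator B"
    using 0 by (auto simp: rel_ker_def)
  ultimately show ?thesis using d by (simp add: adapted_def)
qed

text \<open>\<open>f\<close> is a bounded skew generalised inverse of \<open>T\<close>. It serves
  both to flatten \<open>T\<close> and to split the product space along \<open>T\<close> and
  \<open>complement B g\<close>.\<close>

lemma adapted_graph:
  assumes ad: "adapted T B g"
  obtains f where "bounded_linear f" "\<And>y. (f y, y - proj_right B g y) \<in> T"
    "\<And>y y'. \<Omega> (f y) y' + \<Omega> (f y') y = 0" "\<And>y b. b \<in> B \<Longrightarrow> \<Omega> (f y) (g b) = 0"
proof -
  have T: "lagrangian T" and d: "dual_system B g" and kr: "rel_ker T = span B" "Range T = annihilator B"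
    using ad by (auto simp: adapted_def)
  note sub = lagrangian_subspace[OF T]
  \<comment> \<open>Preimages under \<open>T\<close> are determined up to \<open>span B\<close>;
    vanishing against all \<open>g b\<close> selects one of them by a closed condition.\<close>
  define A where "A = {(x, y). (x, y - proj_right B g y) \<in> T \<and> (\<forall>b\<in>B. \<Omega> x (g b) = 0)}"
  interpret proj_right: bounded_linear "proj_right B g" by (rule bounded_linear_proj_right)
  have clA: "closed A"
  proof -
    have "A = (\<lambda>z. (fst z, snd z - proj_right B g (snd z))) -` T \<inter> (\<Inter>b\<in>B. {z. \<Omega> (fst z) (g b) = 0})"
      by (auto simp: A_def)
    moreover have "closed ((\<lambda>z. (fst z, snd z - proj_right B g (snd z))) -` T)"
      by (intro closed_vimage lagrangian_closed[OF T] continuous_intros proj_right.continuous_on)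
    moreover have "closed (\<Inter>b\<in>B. {z :: 'x \<times> 'y. \<Omega> (fst z) (g b) = 0})"
      by (intro closed_INT ballI closed_Collect_eq continuous_intros
          bounded_linear.continuous_on[OF bounded_linear_left])
    ultimately show ?thesis by (simp add: closed_Int)
  qed
  have subA: "subspace A"
    unfolding subspace_def
  proof (intro conjI ballI allI)
    show "0 \<in> A" using subspace_0[OF sub] by (simp add: A_def zero_prod_def proj_right.zero zero_left)
  next
    fix z w assume "z \<in> A" "w \<in> A"
    then show "z + w \<in> A"
      using subspace_add[OF sub, of "(fst z, snd z - proj_right B g (snd z))" "(fst w, snd w - proj_right B g (snd w))"]
      by (auto simp: A_def proj_right.add add_left algebra_simps)
  next
    fix c z assume "z \<in> A"
    then show "c *\<^sub>R z \<in> A" using subspace_scale[OF sub, of "(fst z, snd z - proj_right B g (snd z))" c]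
      by (auto simp: A_def proj_right.scaleR scaleR_left algebra_simps)
  qed
  have ex: "\<exists>x. (x, y) \<in> A" for y
  proof -
    have "y - proj_right B g y \<in> Range T" using diff_proj_right_in_annihilator[OF d] kr by simp
    then obtain x where x: "(x, y - proj_right B g y) \<in> T" by blast
    have "(proj_left B g x, 0) \<in> T" using proj_left_in_span kr(1) by (auto simp: rel_ker_def)
    then have "(x - proj_left B g x, y - proj_right B g y) \<in> T" using subspace_diff[OF sub x] by fastforce
    then show ?thesis
      using pair_proj_left[OF d] by (auto simp: A_def diff_left intro!: exI[of _ "x - proj_left B g x"])
  qed
  have uniq: "x = x'" if "(x, y) \<in> A" "(x', y) \<in> A" for x x' y
  proof -
    have "(x - x', 0) \<in> A" using subspace_diff[OF subA that] by simp
    then have "x - x' \<in> rel_ker T" "\<And>b. b \<in> B \<Longrightarrow> \<Omega> (x - x') (g b) = 0"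
      by (auto simp: A_def rel_ker_def proj_right.zero)
    then show ?thesis using span_eq_0[OF d, of "x - x'"] kr by simp
  qed
  define f where "f y = (SOME x. (x, y) \<in> A)" for y
  have fA: "(f y, y) \<in> A" for y unfolding f_def using ex by (rule someI_ex)
  have lin: "linear f"
  proof (rule linearI)
    show "f (y + y') = f y + f y'" for y y'
      by (rule uniq[OF fA]) (use subspace_add[OF subA fA[of y] fA[of y']] in simp)
    show "f (c *\<^sub>R y) = c *\<^sub>R f y" for c y
      by (rule uniq[OF fA]) (use subspace_scale[OF subA fA[of y], of c] in simp)
  qed
  have "A = {(f y, y) |y. True}"
  proof (intro subset_antisym subrelI)
    fix x y assume "(x, y) \<in> A"
    then have "x = f y" using fA by (rule uniq)
    then show "(x, y) \<in> {(f y, y) |y. True}" by blast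
  qed (use fA in blast)
  then have bl: "bounded_linear f" using closed_graph[OF lin] clA by simp
  have fT: "(f y, y - proj_right B g y) \<in> T" and fg: "\<And>b. b \<in> B \<Longrightarrow> \<Omega> (f y) (g b) = 0" for y
    using fA[of y] by (auto simp: A_def)
  \<comment> \<open>By the normalisation of \<open>f\<close> the projection terms drop out of the
    isotropy relation, leaving skewness on all of \<open>Y\<close>.\<close>
  have ft: "\<Omega> (f y) (proj_right B g y') = 0" for y y'
    using fg by (simp add: proj_right_def sum_right scaleR_right)
  have sk: "\<Omega> (f y) y' + \<Omega> (f y') y = 0" for y y'
    using lagrangian_isotropic[OF T fT[of y] fT[of y']] by (simp add: form_def diff_right ft)
  show ?thesis by (rule that[OF bl fT sk fg])
qed

lemma proj_right_eq_0: "y \<in> annihilator B \<Longrightarrow> proj_right B g y = 0"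
  by (simp add: proj_right_def annihilator_def)

text \<open>The path starts at the flat relation. The shear sends \<open>(x, y)\<close> to
  \<open>(x + t *\<^sub>R f y, y)\<close>, which leaves kernel and range unchanged for every
  \<open>t\<close> and arrives at \<open>T\<close> for \<open>t = 1\<close>.\<close>

lemma path_component_span_annihilator:
  assumes ad: "adapted T B g"
  shows "path_component_of (FR0_sa_space \<Omega>) (span B \<times> annihilator B) T"
proof -
  have T: "lagrangian T" and d: "dual_system B g" and kr: "rel_ker T = span B" "Range T = annihilator B"
    using ad by (auto simp: adapted_def)
  note sub = lagrangian_subspace[OF T]
  note flat = adapted_span_annihilator[OF d]
  obtain f where f: "bounded_linear f" "\<And>y. (f y, y - proj_right B g y) \<in> T"
    "\<And>y y'. \<Omega> (f y) y' + \<Omega> (f y') y = 0" "\<And>y b. b \<in> B \<Longrightarrow> \<Omega> (f y) (g b) = 0"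
    by (rule adapted_graph[OF ad]) (rule that)
  interpret f: bounded_linear f by fact
  define N where "N z = (f (snd z), 0 :: 'y)" for z :: "'x \<times> 'y"
  have N: "infinitesimal_isometry N"
    unfolding infinitesimal_isometry_def
  proof (intro conjI allI)
    show "bounded_linear N" unfolding N_def
      by (intro bounded_linear_Pair bounded_linear_compose[OF f(1)] bounded_linear_snd bounded_linear_zero)
    show "N (N z) = 0" for z by (simp add: N_def f.zero zero_prod_def)
    show "form (N z) w + form z (N w) = 0" for z w
      using f(3)[of "snd z" "snd w"] by (simp add: N_def form_def zero_right)
  qed
  let ?F = "span B \<times> annihilator B"
  have mem: "(x, y) \<in> shear N t ?F \<longleftrightarrow> x - t *\<^sub>R f y \<in> span B \<and> y \<in> annihilator B" for x y t
  proof
    assume "x - t *\<^sub>R f y \<in> span B \<and> y \<in> annihilator B"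
    then have "(x - t *\<^sub>R f y, y) \<in> ?F" by simp
    then have "(x - t *\<^sub>R f y, y) + t *\<^sub>R N (x - t *\<^sub>R f y, y) \<in> shear N t ?F"
      unfolding shear_def by (rule imageI)
    then show "(x, y) \<in> shear N t ?F" by (simp add: N_def)
  qed (auto simp: shear_def N_def)
  have lag: "lagrangian (shear N t ?F)" for t
    using lagrangian_shear[OF N] flat by (simp add: adapted_def)
  have "adapted (shear N t ?F) B g" for t
    unfolding adapted_def
  proof (intro conjI lag d)
    show "rel_ker (shear N t ?F) = span B"
      by (auto simp: rel_ker_def mem f.zero subspace_0[OF subspace_annihilator])
    have "(t *\<^sub>R f y, y) \<in> shear N t ?F" if "y \<in> annihilator B" for y
      using that by (simp add: mem span_zero)
    then have "annihilator B \<subseteq> Range (shear N t ?F)" by blast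
    moreover have "Range (shear N t ?F) \<subseteq> annihilator B" by (auto simp: mem)
    ultimately show "Range (shear N t ?F) = annihilator B" by blast
  qed
  then have "path_component_of (FR0_sa_space \<Omega>) ?F (shear N 1 ?F)"
    using adapted_FR0(1) by (intro path_component_shear[OF N]) blast
  moreover have "T = shear N 1 ?F"
  proof (rule lagrangian_subset_imp_eq[OF T lag], rule subrelI)
    fix x y assume xy: "(x, y) \<in> T"
    then have y: "y \<in> annihilator B" using kr by blast
    then have "(f y, y) \<in> T" using f(2)[of y] by (simp add: proj_right_eq_0)
    then have "(x - f y, 0) \<in> T" using subspace_diff[OF sub xy] by fastforce
    then show "(x, y) \<in> shear N 1 ?F" using y kr(1) by (auto simp: mem rel_ker_def)
  qed
  ultimately show ?thesis by simp
qed

text \<open>Adding to \<open>T\<close> a skew map of rank two that exchanges the directions of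
  \<open>a\<close> and \<open>b\<close> removes both from the kernel as soon as
  \<open>t \<noteq> 0\<close>; the range grows by \<open>g a\<close> and \<open>g b\<close>.\<close>

lemma path_component_remove_two:
  assumes ad: "adapted T B g" and ab: "a \<in> B" "b \<in> B" "a \<noteq> b"
  obtains T' where "adapted T' (B - {a, b}) g" "path_component_of (FR0_sa_space \<Omega>) T T'"
proof -
  have T: "lagrangian T" and d: "dual_system B g" and kr: "rel_ker T = span B" "Range T = annihilator B"
    using ad by (auto simp: adapted_def)
  note sub = lagrangian_subspace[OF T]
  have fin: "finite B" and dd: "\<And>b c. b \<in> B \<Longrightarrow> c \<in> B \<Longrightarrow> \<Omega> b (g c) = (if b = c then 1 else 0)"
    using d by (auto simp: dual_system_def)
  define C where "C x = \<Omega> x (g a) *\<^sub>R g b - \<Omega> x (g b) *\<^sub>R g a" for x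
  have bC: "bounded_linear C"
    unfolding C_def
    by (intro bounded_linear_sub bounded_linear_scaleR_const bounded_linear_left)
  interpret C: bounded_linear C by fact
  define N where "N z = (0 :: 'x, C (fst z))" for z :: "'x \<times> 'y"
  have N: "infinitesimal_isometry N"
    unfolding infinitesimal_isometry_def
  proof (intro conjI allI)
    show "bounded_linear N" unfolding N_def
      by (intro bounded_linear_Pair bounded_linear_compose[OF bC] bounded_linear_fst bounded_linear_zero)
    show "N (N z) = 0" for z by (simp add: N_def C.zero zero_prod_def)
    show "form (N z) w + form z (N w) = 0" for z w
      by (simp add: N_def form_def C_def zero_left diff_right scaleR_right)
  qed
  let ?B = "B - {a, b}"
  have d': "dual_system ?B g" using d by (auto simp: dual_system_def)
  have shearI: "(x, y + t *\<^sub>R C x) \<in> shear N t T" if "(x, y) \<in> T" for x y t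
    using imageI[OF that, of "\<lambda>z. z + t *\<^sub>R N z"] by (simp add: shear_def N_def)
  have shearE: "\<exists>y'. (x, y') \<in> T \<and> y = y' + t *\<^sub>R C x" if "(x, y) \<in> shear N t T" for x y t
    using that by (auto simp: shear_def N_def)
  have adt: "adapted (shear N t T) ?B g" if t: "t \<noteq> 0" for t
    unfolding adapted_def
  proof (intro conjI lagrangian_shear[OF N T] d')
    show "rel_ker (shear N t T) = span ?B"
    proof (intro subset_antisym subsetI)
      fix x assume "x \<in> rel_ker (shear N t T)"
      then obtain y where y: "(x, y) \<in> T" "y + t *\<^sub>R C x = 0"
        using shearE[of x 0 t] by (auto simp: rel_ker_def)
      then have "y \<in> annihilator B" using kr by blast
      then have "\<Omega> a y = 0" "\<Omega> b y = 0" using ab by (auto simp: annihilator_def)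
      moreover have "\<Omega> a (y + t *\<^sub>R C x) = 0" "\<Omega> b (y + t *\<^sub>R C x) = 0"
        using y(2) by (simp_all add: zero_right)
      \<comment> \<open>Pairing with \<open>a\<close> and \<open>b\<close> annihilates
        \<open>y\<close> and reads off the two coefficients of \<open>C x\<close>.\<close>
      ultimately have x0: "\<Omega> x (g a) = 0" "\<Omega> x (g b) = 0"
        using t ab dd by (auto simp: C_def add_right diff_right scaleR_right)
      then have "y = 0" using y(2) by (simp add: C_def)
      then have xB: "x \<in> span B" using y kr by (auto simp: rel_ker_def)
      have "x = proj_left B g x" using proj_left_of_span[OF d xB] by simp
      also have "\<dots> = (\<Sum>c\<in>?B. \<Omega> x (g c) *\<^sub>R c)"
        unfolding proj_left_def using fin x0 by (intro sum.mono_neutral_right) auto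
      also have "\<dots> \<in> span ?B" by (intro span_sum span_scale span_base)
      finally show "x \<in> span ?B" .
    next
      fix x assume x: "x \<in> span ?B"
      have "g a \<in> annihilator ?B" "g b \<in> annihilator ?B"
        using dd ab by (auto simp: annihilator_def)
      then have "C x = 0" using annihilator_span[OF x] by (simp add: C_def)
      moreover have "(x, 0) \<in> T" using x span_mono[of ?B B] kr(1) by (auto simp: rel_ker_def)
      ultimately show "x \<in> rel_ker (shear N t T)" using shearI[of x 0 t] by (simp add: rel_ker_def)
    qed
    show "Range (shear N t T) = annihilator ?B"
    proof (intro subset_antisym subsetI)
      fix y assume "y \<in> Range (shear N t T)"
      then obtain x y' where y: "(x, y') \<in> T" "y = y' + t *\<^sub>R C x"
        using shearE by blast
      then have "y' \<in> annihilator B" using kr by blast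
      then show "y \<in> annihilator ?B"
        using dd ab by (auto simp: y(2) annihilator_def C_def add_right diff_right scaleR_right)
    next
      fix y assume y: "y \<in> annihilator ?B"
      define y0 where "y0 = y - \<Omega> a y *\<^sub>R g a - \<Omega> b y *\<^sub>R g b"
      have "y0 \<in> annihilator B"
        using y dd ab by (auto simp: y0_def annihilator_def diff_right scaleR_right)
      then obtain x0 where x0: "(x0, y0) \<in> T" using kr by blast
      \<comment> \<open>Moving \<open>x0\<close> along the kernel vectors \<open>a\<close> and
        \<open>b\<close> prescribes its pairings with \<open>g a\<close> and \<open>g b\<close>;
        they are chosen so that \<open>t *\<^sub>R C x\<close> restores the part of \<open>y\<close>
        removed in \<open>y0\<close>.\<close>
      define x where "x = x0 + (\<Omega> b y / t - \<Omega> x0 (g a)) *\<^sub>R a + (- \<Omega> a y / t - \<Omega> x0 (g b)) *\<^sub>R b"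
      have "(a, 0) \<in> T" "(b, 0) \<in> T" using kr(1) ab span_base by (auto simp: rel_ker_def)
      then have "(x0, y0) + (\<Omega> b y / t - \<Omega> x0 (g a)) *\<^sub>R (a, 0) + (- \<Omega> a y / t - \<Omega> x0 (g b)) *\<^sub>R (b, 0) \<in> T"
        using x0 by (intro subspace_add[OF sub] subspace_scale[OF sub])
      then have "(x, y0) \<in> T" by (simp add: x_def)
      then have "(x, y0 + t *\<^sub>R C x) \<in> shear N t T" by (rule shearI)
      moreover have "\<Omega> x (g a) = \<Omega> b y / t" "\<Omega> x (g b) = - \<Omega> a y / t"
        using ab dd by (simp_all add: x_def add_left scaleR_left)
      then have "y0 + t *\<^sub>R C x = y" using t by (simp add: C_def y0_def scaleR_right_diff_distrib scaleR_right_distrib)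
      ultimately show "y \<in> Range (shear N t T)" by auto
    qed
  qed
  have "shear N t T \<in> FR0_sa \<Omega>" for t
    using adapted_FR0(1)[OF adt] adapted_FR0(1)[OF ad] by (cases "t = 0") auto
  then have "path_component_of (FR0_sa_space \<Omega>) T (shear N 1 T)"
    by (rule path_component_shear[OF N])
  then show ?thesis using that adt[of 1] by simp
qed

lemma path_component_lines:
  assumes "e \<noteq> 0" "e' \<noteq> 0"
  shows "path_component_of (FR0_sa_space \<Omega>) (span {e} \<times> annihilator {e}) (span {e'} \<times> annihilator {e'})"
proof (cases "e' \<in> span {e}")
  case True
  then obtain k where k: "e' = k *\<^sub>R e" by (auto simp: span_singleton)
  then have "k \<noteq> 0" using assms by auto
  have "span {e'} = span {e}"
  proof
    show "span {e'} \<subseteq> span {e}" using True by (simp add: span_minimal)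
    have "e = inverse k *\<^sub>R e'" using \<open>k \<noteq> 0\<close> k by simp
    then have "e \<in> span {e'}" unfolding span_singleton by blast
    then show "span {e} \<subseteq> span {e'}" by (simp add: span_minimal)
  qed
  moreover have "annihilator {e'} = annihilator {e}"
    using k \<open>k \<noteq> 0\<close> by (simp add: annihilator_def scaleR_left)
  moreover obtain g where "dual_system {e} g"
    using dual_system_exists[of "{e}"] assms by auto
  then have "span {e} \<times> annihilator {e} \<in> FR0_sa \<Omega>"
    by (rule adapted_FR0(1)[OF adapted_span_annihilator])
  ultimately show ?thesis
    by (simp add: path_component_of_refl topspace_FR0_sa_space)
next
  case False
  then have ne: "e \<noteq> e'" using span_base[of e "{e}"] by auto
  have "independent {e', e}" using False assms ne by (simp add: independent_insert)
  then obtain g where g: "dual_system {e', e} g" using dual_system_exists[of "{e', e}"] by auto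
  \<comment> \<open>\<open>h\<close> pairs to 1 with both \<open>e\<close> and \<open>e'\<close>,
    hence with every point of the segment between them, which therefore avoids 0. The resulting
    \<open>\<Omega> u h = 0\<close> makes \<open>N\<close> square to zero.\<close>
  define h where "h = g e + g e'"
  define u where "u = e' - e"
  have eh: "\<Omega> e h = 1" and uh: "\<Omega> u h = 0"
    using g ne by (simp_all add: dual_system_def h_def u_def add_right diff_left)
  \<comment> \<open>The first component carries \<open>e\<close> to
    \<open>e + t *\<^sub>R u\<close>; the second is its negative \<Omega>-adjoint, as an
    infinitesimal isometry requires.\<close>
  define N where "N z = (\<Omega> (fst z) h *\<^sub>R u, - \<Omega> u (snd z) *\<^sub>R h)" for z :: "'x \<times> 'y"
  have N: "infinitesimal_isometry N"
    unfolding infinitesimal_isometry_def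
  proof (intro conjI allI)
    show "bounded_linear N" unfolding N_def
      by (intro bounded_linear_Pair bounded_linear_scaleR_const bounded_linear_minus
          bounded_linear_compose[OF bounded_linear_left bounded_linear_fst]
          bounded_linear_compose[OF bounded_linear_right bounded_linear_snd])
    show "N (N z) = 0" for z by (simp add: N_def scaleR_left scaleR_right uh zero_prod_def minus_right)
    show "form (N z) w + form z (N w) = 0" for z w
      by (simp add: N_def form_def scaleR_left scaleR_right minus_right)
  qed
  let ?e = "\<lambda>t. e + t *\<^sub>R u"
  let ?F = "\<lambda>e. span {e} \<times> annihilator {e}"
  have d: "dual_system {?e t} (\<lambda>_. h)" for t
    by (simp add: dual_system_def add_left scaleR_left eh uh)
  have ad: "adapted (?F (?e t)) {?e t} (\<lambda>_. h)" for t
    using adapted_span_annihilator[OF d] .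
  have "shear N t (?F e) = ?F (?e t)" for t
  proof (rule lagrangian_subset_imp_eq)
    show "lagrangian (shear N t (?F e))"
      using lagrangian_shear[OF N] ad[of 0] by (simp add: adapted_def)
    show "lagrangian (?F (?e t))" using ad by (simp add: adapted_def)
    show "shear N t (?F e) \<subseteq> ?F (?e t)"
    proof
      fix w assume "w \<in> shear N t (?F e)"
      then obtain x y where xy: "x \<in> span {e}" "\<Omega> e y = 0" "w = (x, y) + t *\<^sub>R N (x, y)"
        by (auto simp: shear_def annihilator_def)
      then obtain k where k: "x = k *\<^sub>R e" by (auto simp: span_singleton)
      have "w = (k *\<^sub>R ?e t, y - (t * \<Omega> u y) *\<^sub>R h)"
        by (simp add: xy(3) k N_def scaleR_left eh algebra_simps)
      moreover have "\<Omega> (?e t) (y - (t * \<Omega> u y) *\<^sub>R h) = 0"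
        by (simp add: add_left scaleR_left diff_right scaleR_right xy(2) eh uh)
      ultimately show "w \<in> ?F (?e t)"
        by (simp add: annihilator_def span_base span_scale)
    qed
  qed
  then have eq: "shear N t (?F e) = ?F (?e t)" for t by blast
  have "path_component_of (FR0_sa_space \<Omega>) (?F e) (shear N 1 (?F e))"
    by (rule path_component_shear[OF N]) (unfold eq, rule adapted_FR0(1)[OF ad])
  then show ?thesis unfolding eq by (simp add: u_def)
qed

lemma path_component_normal_form:
  assumes "adapted T B g"
  shows "\<exists>B'. path_component_of (FR0_sa_space \<Omega>) T (span B' \<times> annihilator B') \<and>
     (even (card B) \<and> B' = {} \<or> odd (card B) \<and> (\<exists>e. e \<noteq> 0 \<and> B' = {e}))"
  using assms
proof (induction "card B" arbitrary: T B rule: less_induct)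
  case less
  have d: "dual_system B g" and fin: "finite B"
    using less.prems by (auto simp: adapted_def dual_system_def)
  show ?case
  proof (cases "\<exists>a\<in>B. \<exists>b\<in>B. a \<noteq> b")
    case True
    then obtain a b where ab: "a \<in> B" "b \<in> B" "a \<noteq> b" by blast
    obtain T' where T': "adapted T' (B - {a, b}) g" "path_component_of (FR0_sa_space \<Omega>) T T'"
      using path_component_remove_two[OF less.prems ab] .
    have "card (B - {a, b}) = card B - 2" "2 \<le> card B"
      using card_Diff_subset[of "{a, b}" B] card_mono[of B "{a, b}"] ab fin by simp_all
    then have c: "card B = card (B - {a, b}) + 2" by simp
    then have "card (B - {a, b}) < card B" by simp
    then obtain B' where B': "path_component_of (FR0_sa_space \<Omega>) T' (span B' \<times> annihilator B')"
      "even (card (B - {a, b})) \<and> B' = {} \<or> odd (card (B - {a, b})) \<and> (\<exists>e. e \<noteq> 0 \<and> B' = {e})"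
      using less.hyps[OF _ T'(1)] by blast
    have "even (card B) \<longleftrightarrow> even (card (B - {a, b}))" unfolding c by simp
    then show ?thesis
      using path_component_of_trans[OF T'(2) B'(1)] B'(2) by blast
  next
    case False
    have p: "path_component_of (FR0_sa_space \<Omega>) T (span B \<times> annihilator B)"
      using path_component_of_sym[OF path_component_span_annihilator[OF less.prems]] .
    show ?thesis
    proof (cases "B = {}")
      case True
      then show ?thesis using p by (intro exI[of _ "{}"]) simp
    next
      case ne: False
      then obtain e where e: "B = {e}" using False by blast
      have "e \<noteq> 0" using dual_system_independent[OF d] unfolding e by simp
      then show ?thesis using p e by (intro exI[of _ "{e}"]) simp
    qed
  qed
qed

subsection \<open>Local constancy of the parity\<close>

definition complement :: "'x set \<Rightarrow> ('x \<Rightarrow> 'y) \<Rightarrow> ('x \<times> 'y) set" where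
  "complement B g = {z. (\<forall>b\<in>B. \<Omega> (fst z) (g b) = 0) \<and> snd z = proj_right B g (snd z)}"

lemma subspace_complement: "subspace (complement B g)"
proof -
  interpret proj_right: bounded_linear "proj_right B g" by (rule bounded_linear_proj_right)
  show ?thesis
    by (auto simp: subspace_def complement_def zero_left add_left scaleR_left proj_right.zero proj_right.add proj_right.scaleR)
qed

lemma closed_complement: "closed (complement B g)"
proof -
  interpret proj_right: bounded_linear "proj_right B g" by (rule bounded_linear_proj_right)
  have "complement B g = (\<Inter>b\<in>B. {z. \<Omega> (fst z) (g b) = 0}) \<inter> {z. snd z = proj_right B g (snd z)}"
    by (auto simp: complement_def)
  moreover have "closed (\<Inter>b\<in>B. {z :: 'x \<times> 'y. \<Omega> (fst z) (g b) = 0})"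
    by (intro closed_INT ballI closed_Collect_eq continuous_intros
        bounded_linear.continuous_on[OF bounded_linear_left])
  moreover have "closed {z :: 'x \<times> 'y. snd z = proj_right B g (snd z)}"
    by (intro closed_Collect_eq continuous_intros proj_right.continuous_on)
  ultimately show ?thesis by (simp add: closed_Int)
qed

lemma complement_isotropic:
  assumes "z \<in> complement B g" "w \<in> complement B g"
  shows "form z w = 0"
proof -
  have "\<Omega> (fst z) (snd w) = 0" if "z \<in> complement B g" "w \<in> complement B g" for z w
  proof -
    have "\<Omega> (fst z) (proj_right B g (snd w)) = 0"
      using that(1) by (simp add: complement_def proj_right_def sum_right scaleR_right)
    moreover have "snd w = proj_right B g (snd w)" using that(2) by (simp add: complement_def)
    ultimately show ?thesis by (rule ssubst[rotated])
  qed
  then show ?thesis using assms by (simp add: form_def)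
qed

text \<open>Only the sum is required to be everything: for a Lagrangian \<open>T\<close>, trivial
  intersection follows from isotropy of both spaces.\<close>

definition transversal :: "('x \<times> 'y) set \<Rightarrow> 'x set \<Rightarrow> ('x \<Rightarrow> 'y) \<Rightarrow> bool" where
  "transversal T B g \<longleftrightarrow> (\<forall>z. \<exists>t\<in>T. z - t \<in> complement B g)"

text \<open>\<open>P\<close> is a bounded splitting map for \<open>T0\<close>. For \<open>T\<close>
  close to \<open>T0\<close>, replacing \<open>P z\<close> by a nearby \<open>t \<in> T\<close>
  decomposes \<open>z\<close> up to half its norm, and successive approximation makes this
  exact.\<close>

lemma transversal_near:
  assumes ad: "adapted T0 B g"
  shows "\<exists>e>0. \<forall>T. subspace T \<longrightarrow> closed T \<longrightarrow> gap T0 T < e \<longrightarrow> transversal T B g"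
proof -
  have T0: "lagrangian T0" and d: "dual_system B g" and kr: "rel_ker T0 = span B" "Range T0 = annihilator B"
    using ad by (auto simp: adapted_def)
  note sub0 = lagrangian_subspace[OF T0]
  obtain f where f: "bounded_linear f" "\<And>y. (f y, y - proj_right B g y) \<in> T0"
    "\<And>y y'. \<Omega> (f y) y' + \<Omega> (f y') y = 0" "\<And>y b. b \<in> B \<Longrightarrow> \<Omega> (f y) (g b) = 0"
    by (rule adapted_graph[OF ad]) (rule that)
  define P where "P z = (proj_left B g (fst z) + f (snd z), snd z - proj_right B g (snd z))" for z
  have blP: "bounded_linear P"
    unfolding P_def
    by (intro bounded_linear_Pair bounded_linear_add bounded_linear_sub bounded_linear_snd
        bounded_linear_compose[OF bounded_linear_proj_left bounded_linear_fst]
        bounded_linear_compose[OF f(1) bounded_linear_snd]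
        bounded_linear_compose[OF bounded_linear_proj_right bounded_linear_snd])
  obtain K where K: "K > 0" "\<forall>z. norm (P z) \<le> norm z * K"
    using bounded_linear.pos_bounded[OF blP] by blast
  have PT: "P z \<in> T0" for z
  proof -
    have "(proj_left B g (fst z), 0) \<in> T0" using proj_left_in_span kr(1) by (auto simp: rel_ker_def)
    then show ?thesis using subspace_add[OF sub0 _ f(2)[of "snd z"]] by (force simp: P_def)
  qed
  have PL: "z - P z \<in> complement B g" for z
  proof -
    have "proj_right B g (proj_right B g y) = proj_right B g y" for y
      unfolding proj_right_def[of _ _ "proj_right B g y"] using pair_proj_right[OF d] by (simp add: proj_right_def)
    then show ?thesis
      using pair_proj_left[OF d] f(4) by (simp add: complement_def P_def diff_left add_left)
  qed
  have "transversal T B g" if T: "subspace T" "closed T" "gap T0 T < 1 / (2 * K)" for T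
    unfolding transversal_def
  proof
    fix z0
    \<comment> \<open>The graph of addition on \<open>T \<times> complement B g\<close>; it is
      closed, and surjectivity onto \<open>z0\<close> is transversality.\<close>
    let ?A = "{((t, l), z). t \<in> T \<and> l \<in> complement B g \<and> z = t + l}"
    have "\<exists>u. (u, z0) \<in> ?A \<and> norm u \<le> 2 * (2 * K + 2) * norm z0"
    proof (rule surjective_by_approximation)
      show "subspace ?A"
        unfolding subspace_def
      proof (intro conjI ballI allI)
        show "0 \<in> ?A" using subspace_0[OF T(1)] subspace_0[OF subspace_complement] by (simp add: zero_prod_def)
      next
        fix v w assume "v \<in> ?A" "w \<in> ?A"
        then show "v + w \<in> ?A"
          using subspace_add[OF T(1)] subspace_add[OF subspace_complement] by (auto simp: algebra_simps)
      next
        fix c v assume "v \<in> ?A"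
        then show "c *\<^sub>R v \<in> ?A"
          using subspace_scale[OF T(1)] subspace_scale[OF subspace_complement] by (auto simp: algebra_simps)
      qed
      have "?A = (T \<times> complement B g) \<times> UNIV \<inter> {v. snd v = fst (fst v) + snd (fst v)}"
        by auto
      moreover have "closed ((T \<times> complement B g) \<times> (UNIV :: ('x \<times> 'y) set))"
        by (intro closed_Times T closed_complement closed_UNIV)
      moreover have "closed {v :: (('x \<times> 'y) \<times> ('x \<times> 'y)) \<times> ('x \<times> 'y). snd v = fst (fst v) + snd (fst v)}"
        by (intro closed_Collect_eq continuous_intros)
      ultimately show "closed ?A" by (simp add: closed_Int)
      show "0 \<le> 2 * K + 2" using K by simp
    next
      fix z :: "'x \<times> 'y"
      have "gap_delta T0 T < 1 / (2 * K)" using T(3) by (simp add: gap_def)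
      then obtain t where t: "t \<in> T" "norm (P z - t) \<le> 1 / (2 * K) * norm (P z)"
        using gap_delta_less[OF sub0 T(1) _ PT] by blast
      have Pz: "norm (P z) \<le> norm z * K" using K by blast
      then have "1 / (2 * K) * norm (P z) \<le> 1 / (2 * K) * (norm z * K)"
        using K(1) by (intro mult_left_mono) auto
      also have "\<dots> = norm z / 2" using K(1) by simp
      finally have tz: "norm (P z - t) \<le> norm z / 2" using t(2) by linarith
      \<comment> \<open>The norms of \<open>t\<close> and \<open>z - P z\<close> are at most
        \<open>K + 1/2\<close> and \<open>K + 1\<close> times \<open>norm z\<close>; their sum is
        rounded up to \<open>2 * K + 2\<close>.\<close>
      have "norm t \<le> norm (P z) + norm (P z - t)"
        using norm_triangle_ineq4[of "P z" "P z - t"] by simp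
      moreover have "norm (z - P z) \<le> norm z + norm (P z)" by (rule norm_triangle_ineq4)
      moreover have "norm (t, z - P z) \<le> norm t + norm (z - P z)" by (rule norm_Pair_le)
      moreover have "(2 * K + 2) * norm z = 2 * (norm z * K) + 2 * norm z" by (simp add: algebra_simps)
      ultimately have "norm (t, z - P z) \<le> (2 * K + 2) * norm z"
        using tz Pz norm_ge_zero[of z] by linarith
      moreover have "z - (t + (z - P z)) = P z - t" by simp
      ultimately show "\<exists>u z'. (u, z') \<in> ?A \<and> norm u \<le> (2 * K + 2) * norm z \<and> norm (z - z') \<le> norm z / 2"
        using t(1) PL[of z] tz by (intro exI[of _ "(t, z - P z)"] exI[of _ "t + (z - P z)"]) simp
    qed
    then obtain t l where "t \<in> T" "l \<in> complement B g" "z0 = t + l" by blast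
    then show "\<exists>t\<in>T. z0 - t \<in> complement B g" by (intro bexI[of _ t]) simp_all
  qed
  then show ?thesis using K(1) by (intro exI[of _ "1 / (2 * K)"]) simp
qed

text \<open>Transversality to the complement makes \<open>T\<close> the graph of a skew map; on \<open>span B\<close> this map is an
  alternating form whose radical is a copy of the kernel of \<open>T\<close>.\<close>

lemma transversal_parity:
  assumes ad: "adapted T B' g'" and d: "dual_system B g" and tr: "transversal T B g"
  shows "even (card B) \<longleftrightarrow> even (card B')"
proof -
  have T: "lagrangian T" and d': "dual_system B' g'" and kr: "rel_ker T = span B'"
    using ad by (auto simp: adapted_def)
  note sub = lagrangian_subspace[OF T]
  let ?L = "complement B g"
  note subL = subspace_complement[of B g]
  interpret proj_right: bounded_linear "proj_right B g" by (rule bounded_linear_proj_right)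
  interpret proj_left: bounded_linear "proj_left B g" by (rule bounded_linear_proj_left)
  \<comment> \<open>A common vector is orthogonal to both isotropic spaces, hence to their sum,
    which is everything.\<close>
  have TL: "z = 0" if z: "z \<in> T" "z \<in> ?L" for z
  proof (rule form_nondegenerate)
    fix w
    obtain t where t: "t \<in> T" "w - t \<in> ?L" using tr unfolding transversal_def by blast
    have "form z t = 0" "form z (w - t) = 0"
      using lagrangian_isotropic[OF T z(1) t(1)] complement_isotropic[OF z(2) t(2)] .
    then show "form z w = 0" by (simp add: form_linear)
  qed
  have "\<forall>x. \<exists>t. t \<in> T \<and> (x, 0) - t \<in> ?L" using tr unfolding transversal_def by blast
  then obtain \<tau> where "\<forall>x. \<tau> x \<in> T \<and> (x, 0) - \<tau> x \<in> ?L" by (rule choice[THEN exE])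
  then have \<tau>: "\<And>x. \<tau> x \<in> T" "\<And>x. (x, 0) - \<tau> x \<in> ?L" by blast+
  have \<tau>_unique: "\<tau> x = t" if "t \<in> T" "(x, 0) - t \<in> ?L" for x t
  proof -
    have "\<tau> x - t \<in> T" using subspace_diff[OF sub \<tau>(1) that(1)] .
    moreover have "\<tau> x - t = ((x, 0) - t) - ((x, 0) - \<tau> x)" by simp
    then have "\<tau> x - t \<in> ?L" using subspace_diff[OF subL that(2) \<tau>(2)[of x]] by simp
    ultimately show ?thesis using TL by fastforce
  qed
  have \<tau>_lin: "linear \<tau>"
  proof (rule linearI)
    fix x x'
    have "(x + x', 0) - (\<tau> x + \<tau> x') = ((x, 0) - \<tau> x) + ((x', 0) - \<tau> x')"
      by (simp add: prod_eq_iff)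
    also have "\<dots> \<in> ?L" using \<tau>(2) by (intro subspace_add[OF subL])
    finally show "\<tau> (x + x') = \<tau> x + \<tau> x'" using \<tau>_unique subspace_add[OF sub \<tau>(1) \<tau>(1)] by blast
  next
    fix c x
    have "(c *\<^sub>R x, 0) - c *\<^sub>R \<tau> x = c *\<^sub>R ((x, 0) - \<tau> x)" by (simp add: prod_eq_iff scaleR_right_diff_distrib)
    also have "\<dots> \<in> ?L" using \<tau>(2) by (intro subspace_scale[OF subL])
    finally show "\<tau> (c *\<^sub>R x) = c *\<^sub>R \<tau> x" using \<tau>_unique subspace_scale[OF sub \<tau>(1)] by blast
  qed
  interpret \<tau>: linear \<tau> by fact
  \<comment> \<open>\<tau> takes the \<open>T\<close>-component of \<open>(x, 0)\<close>, so
    \<open>\<beta> x w\<close> is \<open>form (w, 0) (\<tau> x)\<close>.\<close>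
  define \<beta> where "\<beta> x w = \<Omega> w (snd (\<tau> x))" for x w
  have bil: "bilinear \<beta>"
    unfolding bilinear_def \<beta>_def
    by (intro conjI allI linearI)
      (simp_all add: add_left scaleR_left add_right scaleR_right \<tau>.add \<tau>.scale)
  have alt: "\<beta> x x = 0" for x
  proof -
    \<comment> \<open>Since \<open>(x, 0)\<close>, \<open>\<tau> x\<close> and \<open>?l\<close> are
      all isotropic, expanding \<open>form (x, 0) (x, 0)\<close> shows that the cross term of
      \<open>\<tau> x\<close> and \<open>?l\<close> vanishes.\<close>
    let ?l = "(x, 0) - \<tau> x"
    have "form (\<tau> x) (\<tau> x) = 0" "form ?l ?l = 0"
      using lagrangian_isotropic[OF T \<tau>(1) \<tau>(1)] complement_isotropic[OF \<tau>(2) \<tau>(2)] .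
    moreover have "form (x, 0) (x, 0) = 0" by (simp add: form_def zero_right)
    ultimately have "form (x, 0) (\<tau> x) = 0"
      using form_commute[of "(x, 0)" "\<tau> x"] by (simp add: form_linear)
    then show ?thesis by (simp add: form_def \<beta>_def zero_right)
  qed
  \<comment> \<open>So \<beta> depends only on the projections to \<open>span B\<close>, and testing
    its radical there tests it against all of \<open>X\<close>.\<close>
  have zeroL: "\<beta> x w = 0" "\<beta> w x = 0" if "(x, 0) \<in> ?L" for x w
  proof -
    have "\<tau> x = 0" using that by (intro \<tau>_unique subspace_0[OF sub]) simp
    then show "\<beta> x w = 0" by (simp add: \<beta>_def zero_right)
    then show "\<beta> w x = 0" using alternating_antisym[OF bil alt, of x w] by simp
  qed
  have memL: "(x, 0) \<in> ?L \<longleftrightarrow> (\<forall>b\<in>B. \<Omega> x (g b) = 0)" for x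
    by (simp add: complement_def proj_right.zero)
  have proj_leftL: "(x - proj_left B g x, 0) \<in> ?L" for x
    using pair_proj_left[OF d] by (simp add: memL diff_left)
  let ?R = "{v \<in> span B. \<forall>w\<in>span B. \<beta> v w = 0}"
  obtain C where C: "finite C" "independent C" "span C = ?R" "even (card B) \<longleftrightarrow> even (card C)"
    using alternating_radical[OF bil alt _ dual_system_independent[OF d]] d
    unfolding dual_system_def by blast
  \<comment> \<open>For \<open>(a, 0) \<in> T\<close> the vector \<open>a\<close> and its projection
    differ by an element of \<open>?L\<close>, so \<tau> maps the projection to
    \<open>(a, 0)\<close>, with second component 0. Conversely, a radical vector \<open>v\<close>
    has \<open>snd (\<tau> v) = 0\<close>, so \<open>fst (\<tau> v)\<close> is in the
    kernel.\<close>
  have im: "proj_left B g ` span B' = ?R"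
  proof (intro subset_antisym subsetI)
    fix v assume "v \<in> proj_left B g ` span B'"
    then obtain a where a: "(a, 0) \<in> T" "v = proj_left B g a" using kr by (auto simp: rel_ker_def)
    have "(v, 0) - (a, 0) = - (a - proj_left B g a, 0 :: 'y)" using a by (simp add: prod_eq_iff)
    then have "(v, 0) - (a, 0) \<in> ?L" using subspace_neg[OF subL proj_leftL[of a]] by simp
    then have "\<tau> v = (a, 0)" using \<tau>_unique a(1) by blast
    then show "v \<in> ?R" using a(2) proj_left_in_span by (simp add: \<beta>_def zero_right)
  next
    fix v assume v: "v \<in> ?R"
    have "\<Omega> x (snd (\<tau> v)) = 0" for x
    proof -
      have "\<beta> v x = \<beta> v (proj_left B g x) + \<beta> v (x - proj_left B g x)"
        using bilinear_radd[OF bil, of v "proj_left B g x" "x - proj_left B g x"] by simp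
      also have "\<dots> = 0" using v proj_left_in_span zeroL(2)[OF proj_leftL] by simp
      finally show ?thesis by (simp add: \<beta>_def)
    qed
    then have "snd (\<tau> v) = 0" by (rule eq_0_right)
    then have a: "\<tau> v = (fst (\<tau> v), 0)" by (simp add: prod_eq_iff)
    then have "(v, 0) - \<tau> v = (v - fst (\<tau> v), 0)" by (simp add: prod_eq_iff)
    then have "(v - fst (\<tau> v), 0) \<in> ?L" using \<tau>(2)[of v] by simp
    then have "proj_left B g (v - fst (\<tau> v)) = 0" by (simp add: memL proj_left_def)
    then have "v = proj_left B g (fst (\<tau> v))"
      using proj_left_of_span[OF d, of v] v by (simp add: proj_left.diff)
    moreover have "fst (\<tau> v) \<in> span B'" using a \<tau>(1)[of v] kr by (auto simp: rel_ker_def)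
    ultimately show "v \<in> proj_left B g ` span B'" by blast
  qed
  have inj: "inj_on (proj_left B g) (span B')"
  proof (rule inj_onI)
    fix x y assume xy: "x \<in> span B'" "y \<in> span B'" "proj_left B g x = proj_left B g y"
    then have "(x - y, 0) \<in> T" using kr span_diff[OF xy(1,2)] by (auto simp: rel_ker_def)
    moreover have "(x - y, 0) \<in> ?L" using proj_leftL[of "x - y"] xy(3) by (simp add: proj_left.diff)
    ultimately have "(x - y, 0) = (0 :: 'x \<times> 'y)" by (rule TL)
    then show "x = y" by (simp add: zero_prod_def)
  qed
  have linh: "linear (proj_left B g)" by (rule proj_left.linear_axioms)
  have ind: "independent (proj_left B g ` B')"
    using linear_independent_injective_image[OF linh dual_system_independent[OF d'] inj] .
  have "inj_on (proj_left B g) B'" using inj span_superset by (rule inj_on_subset)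
  then have "card B' = card (proj_left B g ` B')" by (simp add: card_image)
  also have "\<dots> = card C"
  proof -
    have "span (proj_left B g ` B') = span C"
      using linear_span_image[OF linh, of B'] im C(3) by simp
    then show ?thesis using dim_eq_card[OF _ ind] dim_eq_card_independent[OF C(2)] by metis
  qed
  finally show ?thesis using C(4) by simp
qed

lemma parity_locally_constant:
  assumes "T0 \<in> FR0_sa \<Omega>"
  shows "\<exists>r>0. \<forall>T\<in>FR0_sa \<Omega>. gap T0 T < r \<longrightarrow> dim (rel_ker T) mod 2 = dim (rel_ker T0) mod 2"
proof -
  obtain B g where ad: "adapted T0 B g" using FR0_adapted[OF assms] .
  obtain e where e: "e > 0"
    "\<And>T. subspace T \<Longrightarrow> closed T \<Longrightarrow> gap T0 T < e \<Longrightarrow> transversal T B g"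
    using transversal_near[OF ad] by blast
  have "dim (rel_ker T) mod 2 = dim (rel_ker T0) mod 2" if T: "T \<in> FR0_sa \<Omega>" "gap T0 T < e" for T
  proof -
    obtain B' g' where ad': "adapted T B' g'" using FR0_adapted[OF T(1)] .
    then have lag: "lagrangian T" by (simp add: adapted_def)
    have "transversal T B g"
      using e(2)[OF lagrangian_subspace[OF lag] lagrangian_closed[OF lag] T(2)] .
    then have "even (card B) \<longleftrightarrow> even (card B')"
      using ad by (intro transversal_parity[OF ad']) (simp_all add: adapted_def)
    then show ?thesis unfolding adapted_FR0(2)[OF ad] adapted_FR0(2)[OF ad'] by presburger
  qed
  then show ?thesis using e(1) by blast
qed

section \<open>Clopen parity classes and path components\<close>

lemma openin_FR0_sa_parity: "openin (FR0_sa_space \<Omega>) (FR0_sa_parity a \<Omega>)"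
proof -
  \<comment> \<open>An open set of the whole gap space cutting out the parity class. A union of gap
    balls would require the balls to be open; asking each point for a ball of its own requires only
    the weak triangle inequality.\<close>
  let ?U = "{M \<in> closed_subspaces. \<exists>r>0. \<forall>N\<in>FR0_sa \<Omega>. gap M N < r \<longrightarrow> N \<in> FR0_sa_parity a \<Omega>}"
  have FRcs: "FR0_sa \<Omega> \<subseteq> closed_subspaces"
    by (auto simp: FR0_sa_def fredholm_relation_def closed_subspaces_def)
  have "openin gap_topology ?U"
    unfolding openin_gap_topology
  proof (intro conjI ballI)
    fix M assume "M \<in> ?U"
    then obtain r where M: "subspace M" and r: "r > 0"
        "\<And>N. N \<in> FR0_sa \<Omega> \<Longrightarrow> gap M N < r \<Longrightarrow> N \<in> FR0_sa_parity a \<Omega>"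
      by (auto simp: closed_subspaces_def)
    \<comment> \<open>The bound 1 permits the weak triangle inequality, and \<open>r / 4\<close>
      keeps its factor 3 below \<open>r\<close>.\<close>
    define e where "e = min (r / 4) 1"
    have e: "e > 0" "e \<le> 1" "3 * e < r" using r(1) by (auto simp: e_def min_def)
    have "M' \<in> ?U" if M': "M' \<in> closed_subspaces" "gap M M' < e" for M'
    proof -
      have "N \<in> FR0_sa_parity a \<Omega>" if N: "N \<in> FR0_sa \<Omega>" "gap M' N < e" for N
      proof (rule r(2)[OF N(1)])
        have "gap M N \<le> 3 * e"
          using M M' N FRcs e(2) by (intro gap_weak_triangle[of M M' N]) (auto simp: closed_subspaces_def)
        then show "gap M N < r" using e(3) by simp
      qed
      then show ?thesis using M'(1) e(1) by blast
    qed
    then show "\<exists>e>0. \<forall>N\<in>closed_subspaces. gap M N < e \<longrightarrow> N \<in> ?U" using e(1) by blast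
  qed blast
  moreover have "FR0_sa_parity a \<Omega> = ?U \<inter> FR0_sa \<Omega>"
  proof (intro subset_antisym subsetI)
    fix M assume M: "M \<in> FR0_sa_parity a \<Omega>"
    then have MF: "M \<in> FR0_sa \<Omega>" "dim (rel_ker M) mod 2 = a mod 2" by (simp_all add: FR0_sa_parity_def)
    obtain r where "r > 0"
        "\<forall>T\<in>FR0_sa \<Omega>. gap M T < r \<longrightarrow> dim (rel_ker T) mod 2 = dim (rel_ker M) mod 2"
      using parity_locally_constant[OF MF(1)] by blast
    then have "\<exists>r>0. \<forall>N\<in>FR0_sa \<Omega>. gap M N < r \<longrightarrow> N \<in> FR0_sa_parity a \<Omega>"
      using MF(2) by (auto simp: FR0_sa_parity_def)
    then show "M \<in> ?U \<inter> FR0_sa \<Omega>" using MF(1) FRcs by blast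
  next
    fix M assume "M \<in> ?U \<inter> FR0_sa \<Omega>"
    then obtain r where M: "M \<in> FR0_sa \<Omega>" "M \<in> closed_subspaces" "r > 0"
        "\<And>N. N \<in> FR0_sa \<Omega> \<Longrightarrow> gap M N < r \<Longrightarrow> N \<in> FR0_sa_parity a \<Omega>" by blast
    have "gap M M < r" using gap_self[of M] M(2,3) by (simp add: closed_subspaces_def)
    then show "M \<in> FR0_sa_parity a \<Omega>" using M(4)[OF M(1)] by blast
  qed
  ultimately show ?thesis
    unfolding FR0_sa_space_def openin_subtopology by blast
qed

text \<open>The complement of one parity class is the other, so each class is clopen and a connected
  set meeting it stays inside.\<close>

lemma path_component_of_same_parity:
  assumes "path_component_of (FR0_sa_space \<Omega>) S T" "S \<in> FR0_sa_parity a \<Omega>"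
  shows "T \<in> FR0_sa_parity a \<Omega>"
proof -
  obtain C where C: "path_connectedin (FR0_sa_space \<Omega>) C" "S \<in> C" "T \<in> C"
    using assms(1) unfolding path_component_of by blast
  have "FR0_sa \<Omega> - FR0_sa_parity a \<Omega> = FR0_sa_parity (Suc a) \<Omega>"
    by (auto simp: FR0_sa_parity_def mod_Suc)
  then have "closedin (FR0_sa_space \<Omega>) (FR0_sa_parity a \<Omega>)"
    unfolding closedin_def topspace_FR0_sa_space
    using openin_FR0_sa_parity by (auto simp: FR0_sa_parity_def)
  then have "C \<subseteq> FR0_sa_parity a \<Omega> \<or> disjnt C (FR0_sa_parity a \<Omega>)"
    using connectedin_clopen_cases[OF path_connectedin_imp_connectedin[OF C(1)]] openin_FR0_sa_parity by blast
  then show ?thesis using C assms(2) by (auto simp: disjnt_def)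
qed

lemma path_component_of_parity:
  assumes "S \<in> FR0_sa_parity a \<Omega>" "T \<in> FR0_sa_parity a \<Omega>"
  shows "path_component_of (FR0_sa_space \<Omega>) S T"
proof -
  have normal: "\<exists>B. path_component_of (FR0_sa_space \<Omega>) T (span B \<times> annihilator B) \<and>
      (even a \<and> B = {} \<or> odd a \<and> (\<exists>e. e \<noteq> 0 \<and> B = {e}))" if T: "T \<in> FR0_sa_parity a \<Omega>" for T
  proof -
    have TF: "T \<in> FR0_sa \<Omega>" "dim (rel_ker T) mod 2 = a mod 2" using T by (auto simp: FR0_sa_parity_def)
    obtain B g where ad: "adapted T B g" using FR0_adapted[OF TF(1)] .
    have "even (card B) \<longleftrightarrow> even a" using TF(2) unfolding adapted_FR0(2)[OF ad] by presburger
    then show ?thesis using path_component_normal_form[OF ad] by simp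
  qed
  obtain B where B: "path_component_of (FR0_sa_space \<Omega>) S (span B \<times> annihilator B)"
    "even a \<and> B = {} \<or> odd a \<and> (\<exists>e. e \<noteq> 0 \<and> B = {e})" using normal[OF assms(1)] by blast
  obtain C where C: "path_component_of (FR0_sa_space \<Omega>) T (span C \<times> annihilator C)"
    "even a \<and> C = {} \<or> odd a \<and> (\<exists>e. e \<noteq> 0 \<and> C = {e})" using normal[OF assms(2)] by blast
  have "path_component_of (FR0_sa_space \<Omega>) S (span C \<times> annihilator C)"
  proof (cases "even a")
    case True
    then show ?thesis using B C by simp
  next
    case False
    then obtain e e' where "B = {e}" "e \<noteq> 0" "C = {e'}" "e' \<noteq> 0" using B(2) C(2) by blast
    then have "path_component_of (FR0_sa_space \<Omega>) (span B \<times> annihilator B) (span C \<times> annihilator C)"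
      by (simp add: path_component_lines)
    with B(1) show ?thesis by (rule path_component_of_trans)
  qed
  then show ?thesis using path_component_of_sym[OF C(1)] by (rule path_component_of_trans)
qed

lemma path_component_of_set_eq:
  assumes "T \<in> FR0_sa_parity a \<Omega>"
  shows "path_component_of_set (FR0_sa_space \<Omega>) T = FR0_sa_parity a \<Omega>"
  using path_component_of_same_parity[OF _ assms] path_component_of_parity[OF assms] by blast

text \<open>The vector \<open>x\<close> makes the odd class non-empty: the flat relation over its
  line has a one-dimensional kernel.\<close>

lemma path_components_FR0_sa_space:
  assumes "x \<noteq> (0 :: 'x)"
  shows "path_components_of (FR0_sa_space \<Omega>) = {FR0_sa_parity 0 \<Omega>, FR0_sa_parity 1 \<Omega>}"
    "FR0_sa_parity 0 \<Omega> \<noteq> FR0_sa_parity 1 \<Omega>"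
proof -
  have ex: "span B \<times> annihilator B \<in> FR0_sa_parity (card B) \<Omega>" if B: "finite B" "independent B" for B
  proof -
    obtain g where "dual_system B g" using dual_system_exists[OF B] by blast
    then have ad: "adapted (span B \<times> annihilator B) B g" by (rule adapted_span_annihilator)
    show ?thesis using adapted_FR0[OF ad] by (simp add: FR0_sa_parity_def)
  qed
  have T0: "span {} \<times> annihilator {} \<in> FR0_sa_parity 0 \<Omega>" using ex[OF finite.emptyI independent_empty] by simp
  have T1: "span {x} \<times> annihilator {x} \<in> FR0_sa_parity 1 \<Omega>" using ex[of "{x}"] assms by simp
  have "FR0_sa_parity 0 \<Omega> \<inter> FR0_sa_parity 1 \<Omega> = {}" by (auto simp: FR0_sa_parity_def)
  then show "FR0_sa_parity 0 \<Omega> \<noteq> FR0_sa_parity 1 \<Omega>" using T0 by blast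
  have cases: "FR0_sa \<Omega> = FR0_sa_parity 0 \<Omega> \<union> FR0_sa_parity 1 \<Omega>"
    by (auto simp: FR0_sa_parity_def)
  show "path_components_of (FR0_sa_space \<Omega>) = {FR0_sa_parity 0 \<Omega>, FR0_sa_parity 1 \<Omega>}"
    unfolding path_components_of_def topspace_FR0_sa_space
  proof (intro subset_antisym subsetI)
    fix C assume "C \<in> path_component_of_set (FR0_sa_space \<Omega>) ` FR0_sa \<Omega>"
    then show "C \<in> {FR0_sa_parity 0 \<Omega>, FR0_sa_parity 1 \<Omega>}"
      unfolding cases using path_component_of_set_eq by blast
  next
    fix C assume "C \<in> {FR0_sa_parity 0 \<Omega>, FR0_sa_parity 1 \<Omega>}"
    then show "C \<in> path_component_of_set (FR0_sa_space \<Omega>) ` FR0_sa \<Omega>"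
      unfolding cases using path_component_of_set_eq[OF T0] path_component_of_set_eq[OF T1] T0 T1 by blast
  qed
qed

end

text \<open>If \<open>X\<close> were zero, non-degeneracy would make \<open>Y\<close> zero too; the
  zero relation would be the only one and the odd class would be empty. This is the reason for the
  third assumption.\<close>

theorem theorem1p6:
  fixes \<Omega> :: "'x::banach \<Rightarrow> 'y::banach \<Rightarrow> real"
  assumes "bounded_bilinear \<Omega>"
    and "nondegenerate \<Omega>"
    and "\<exists>x::'x. x \<noteq> 0"
  shows "card (path_components_of (FR0_sa_space \<Omega>)) = 2 \<and>
         path_components_of (FR0_sa_space \<Omega>) = {FR0_sa_parity 0 \<Omega>, FR0_sa_parity 1 \<Omega>}"
proof -
  interpret nondegenerate_pairing \<Omega>
    using assms(1,2) by (simp add: nondegenerate_pairing_def nondegenerate_pairing_axioms_def)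
  obtain x :: 'x where "x \<noteq> 0" using assms(3) by blast
  from path_components_FR0_sa_space[OF this] show ?thesis by simp
qed

end
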